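(* Let $f$ and $g$ be transcendental entire functions. Suppose that there exist constants $a>0$, $b>1$ and $r_0>0$ such that for every $r\geq r_0$ there exists $\rho\in(r,br)$ with $m(\rho,f)\leq a$. Then there exist positive constants $\alpha$ and $\beta$, a sequence $(\xi_k)$ of fixed points of $f\circ g$ with $|\xi_k|\to\infty$ as $k\to\infty$, and a sequence of real numbers $(\delta_k)$ with $\delta_k\to 0$ as $k\to\infty$, such that for all $k$ $$|(f\circ g)'(\xi_k)|\geq \alpha \log M\big(\beta M(|\xi_k|,g),\,f\big)$$ and $$|g(\xi_k)| \geq (1-\delta_k)\,M(|\xi_k|, g).$$
   Context: For an entire function $h$ and $r>0$, $M(r,h)=\max_{|z|=r}|h(z)|$ is the maximum modulus and $m(r,h)=\min_{|z|=r}|h(z)|$ is the minimum modulus. A transcendental entire function is an entire function that is not a polynomial. A fixed point of an entire function $h$ is a point $\xi\in\mathbb{C}$ with $h(\xi)=\xi$. *)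

theory Defs
  imports "HOL-Complex_Analysis.Complex_Analysis"
begin

definition transcendental_entire :: "(complex \<Rightarrow> complex) \<Rightarrow> bool" where
  "transcendental_entire h \<longleftrightarrow>
     h holomorphic_on UNIV \<and> \<not> (\<exists>p :: complex poly. \<forall>z. h z = poly p z)"

text \<open>
  The maximum and minimum modulus are written with \<^const>\<open>Sup\<close> and \<^const>\<open>Inf\<close> over the
  circle \<open>\<bar>z\<bar> = r\<close>. For continuous \<open>h\<close> and \<open>r \<ge> 0\<close> both are attained (see the lemmas below).
\<close>

definition max_modulus :: "real \<Rightarrow> (complex \<Rightarrow> complex) \<Rightarrow> real" where
  "max_modulus r h = (SUP z\<in>sphere 0 r. norm (h z))"

definition min_modulus :: "real \<Rightarrow> (complex \<Rightarrow> complex) \<Rightarrow> real" where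
  "min_modulus r h = (INF z\<in>sphere 0 r. norm (h z))"

lemma max_modulus_attained:
  assumes "continuous_on (sphere 0 r) h" and "r \<ge> 0"
  shows "\<exists>z. norm z = r \<and> norm (h z) = max_modulus r h \<and>
             (\<forall>w. norm w = r \<longrightarrow> norm (h w) \<le> norm (h z))"
proof -
  have "sphere (0::complex) r \<noteq> {}" using assms(2) by simp
  then obtain z where z: "z \<in> sphere 0 r" "\<forall>w\<in>sphere 0 r. norm (h w) \<le> norm (h z)"
    using continuous_attains_sup[OF compact_sphere _ continuous_on_norm[OF assms(1)]] by blast
  have "max_modulus r h = norm (h z)"
    unfolding max_modulus_def by (rule cSup_eq_maximum) (use z in auto)
  with z show ?thesis by auto
qed

lemma min_modulus_attained:
  assumes "continuous_on (sphere 0 r) h" and "r \<ge> 0"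
  shows "\<exists>z. norm z = r \<and> norm (h z) = min_modulus r h \<and>
             (\<forall>w. norm w = r \<longrightarrow> norm (h z) \<le> norm (h w))"
proof -
  have "sphere (0::complex) r \<noteq> {}" using assms(2) by simp
  then obtain z where z: "z \<in> sphere 0 r" "\<forall>w\<in>sphere 0 r. norm (h z) \<le> norm (h w)"
    using continuous_attains_inf[OF compact_sphere _ continuous_on_norm[OF assms(1)]] by blast
  have "min_modulus r h = norm (h z)"
    unfolding min_modulus_def by (rule cInf_eq_minimum) (use z in auto)
  with z show ?thesis by auto
qed

end

theory Submission
  imports Defs
begin

text \<open>
  Near suitable points \<open>z\<close> of maximum modulus, \<open>g (z * exp (s / \<nu>))\<close> is close to \<open>g z * exp s\<close> with
  \<open>\<nu>\<close> large (Wiman--Valiron). Hence a point \<open>w\<close> near \<open>g z\<close> has many preimages under \<open>g\<close> close to \<open>z\<close>, which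
  differ by factors close to \<open>exp (2 * pi * \<i> * j / \<nu>)\<close>, and a fixed point of \<open>f \<circ> g\<close> arises whenever
  \<open>f w\<close> equals one of them. After normalisation these preimages become dense in a
  segment of the imaginary axis. On the annulus \<open>\<bar>g z\<bar> < \<bar>w\<bar> < b * \<bar>g z\<bar>\<close> the normalised \<open>f\<close> takes values
  that are very small compared with its maximum \<open>M\<close> on \<open>\<bar>w\<bar> = \<bar>g z\<bar>\<close>; by Harnack's inequality and
  Zalcman's rescaling it converges, on a scale \<open>1 / Q\<close> with \<open>Q \<ge> const * ln M\<close>, to a
  nonconstant entire function. By Picard's theorem this limit takes some value of the segment at a
  noncritical point, and Hurwitz' theorem yields fixed points with derivative of order at least \<open>Q\<close>.
\<close>

subsection \<open>Maximum modulus\<close>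

text \<open>The scale of \<open>f\<close> has to match the fan of preimages. Adding
  \<open>2 * pi * \<i>\<close> to \<open>S\<close> fixes \<open>g z * exp S\<close> but moves the
  preimage \<open>z * exp (S / \<nu>)\<close> by about \<open>2 * pi * \<i> / \<nu>\<close>,
  relative to \<open>z\<close>. If the exponential law holds for \<open>norm S < m\<close>, the
  function \<open>4 * \<nu> / m * (f (g z * exp s) / z - 1)\<close> turns the preimages into targets
  of spacing about \<open>8 * pi / m\<close>, dense as m grows. The price is a factor that may be as
  large as \<open>2 * norm (g z)\<close>: the bound on the minimum modulus then gives a value of
  order \<open>norm (g z)\<close>, not a bounded one. Transcendence of \<open>f\<close> makes this
  negligible on the logarithmic scale, and Harnack's inequality then produces a value of modulus at
  most 1. In the derivative of \<open>f \<circ> g\<close> the factor \<nu> cancels: undoing the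
  normalisation of \<open>f\<close> divides by \<nu>, and \<open>deriv g\<close> is of order \<nu>.
  Hence the derivative of the normalised \<open>f\<close> alone decides. The shifted preimages are
  written as exact holomorphic functions of the rescaled variable, so that the fixed point equation
  is an equation between two convergent sequences of functions.\<close>

lemma entire_continuous_on:
  assumes "h holomorphic_on (UNIV :: complex set)"
  shows "continuous_on A h"
  using assms holomorphic_on_imp_continuous_on continuous_on_subset by blast

lemma norm_le_max_modulus:
  assumes "h holomorphic_on UNIV"
  shows "norm (h z) \<le> max_modulus (norm z) h"
  using max_modulus_attained[OF entire_continuous_on[OF assms], of "norm z"] by auto

lemma max_modulus_point:
  assumes "h holomorphic_on UNIV" "r \<ge> 0"
  obtains z where "norm z = r" "norm (h z) = max_modulus r h"
  using max_modulus_attained[OF entire_continuous_on[OF assms(1)] assms(2)] by auto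

lemma norm_le_max_modulus_cball:
  assumes "h holomorphic_on UNIV" "norm z \<le> r"
  shows "norm (h z) \<le> max_modulus r h"
proof (cases "r > 0")
  case True
  show ?thesis
  proof (rule maximum_modulus_frontier[of h "cball 0 r"])
    show "h holomorphic_on interior (cball 0 r)"
      using assms(1) holomorphic_on_subset by blast
    show "continuous_on (closure (cball 0 r)) h"
      using entire_continuous_on[OF assms(1)] .
    fix w :: complex assume "w \<in> frontier (cball 0 r)"
    then have "norm w = r" using True by auto
    then show "norm (h w) \<le> max_modulus r h"
      using norm_le_max_modulus[OF assms(1), of w] by simp
  qed (use assms in auto)
next
  case False
  then have "norm z = r" using assms(2) norm_ge_zero[of z] by linarith
  then show ?thesis using norm_le_max_modulus[OF assms(1), of z] by simp
qed

lemma max_modulus_mono: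
  assumes "h holomorphic_on UNIV" "0 \<le> r" "r \<le> s"
  shows "max_modulus r h \<le> max_modulus s h"
  using assms by (metis max_modulus_point norm_le_max_modulus_cball)

lemma transcendental_holomorphic: "transcendental_entire h \<Longrightarrow> h holomorphic_on UNIV"
  by (simp add: transcendental_entire_def)

lemma transcendental_deriv_nonzero:
  assumes "transcendental_entire h"
  shows "\<exists>n\<ge>N. (deriv ^^ n) h 0 \<noteq> 0"
proof (rule ccontr)
  assume neg: "\<not> ?thesis"
  define p where "p = (\<Sum>n<N. monom ((deriv ^^ n) h 0 / fact n) n)"
  have "h z = poly p z" for z
  proof -
    have "((\<lambda>n. (deriv ^^ n) h 0 / (fact n) * (z-0)^n) sums h z)"
      by (rule holomorphic_power_series[of h 0 "norm z + 1"])
         (use assms in \<open>auto simp: transcendental_entire_def intro: holomorphic_on_subset\<close>)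
    moreover have "((\<lambda>n. (deriv ^^ n) h 0 / (fact n) * (z-0)^n) sums
        (\<Sum>n<N. (deriv ^^ n) h 0 / (fact n) * (z-0)^n))"
      by (rule sums_finite) (use neg in \<open>auto simp: not_less\<close>)
    ultimately have "h z = (\<Sum>n<N. (deriv ^^ n) h 0 / (fact n) * z^n)"
      using sums_unique2 by fastforce
    then show ?thesis by (simp add: p_def poly_sum poly_monom)
  qed
  with assms show False by (auto simp: transcendental_entire_def)
qed

text \<open>Cauchy's estimate for a single nonzero Taylor coefficient of index at least
  \<open>N\<close>; the same coefficient serves all radii.\<close>

lemma transcendental_max_modulus_ge:
  assumes "transcendental_entire h"
  shows "\<exists>n c. n \<ge> N \<and> c > 0 \<and> (\<forall>r>0. max_modulus r h \<ge> c * r ^ n)"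
proof -
  note hol = transcendental_holomorphic[OF assms]
  obtain n where n: "n \<ge> N" "(deriv ^^ n) h 0 \<noteq> 0"
    using transcendental_deriv_nonzero[OF assms] by blast
  define c where "c = norm ((deriv ^^ n) h 0) / fact n"
  have "max_modulus r h \<ge> c * r ^ n" if "r > 0" for r
  proof -
    have "norm ((deriv ^^ n) h 0) \<le> fact n * max_modulus r h / r ^ n"
    proof (rule Cauchy_inequality[OF _ entire_continuous_on[OF hol] that])
      show "h holomorphic_on ball 0 r" using hol holomorphic_on_subset by blast
      fix x :: complex assume "norm (0 - x) = r"
      then show "norm (h x) \<le> max_modulus r h" using norm_le_max_modulus[OF hol, of x] by simp
    qed
    then show ?thesis using that by (simp add: c_def field_simps)
  qed
  moreover have "c > 0" using n by (simp add: c_def)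
  ultimately show ?thesis using n by blast
qed

lemma transcendental_max_modulus_pos:
  assumes "transcendental_entire h" "r > 0"
  shows "max_modulus r h > 0"
proof -
  obtain n c where nc: "c > 0" "\<forall>r>0. max_modulus r h \<ge> c * r ^ n"
    using transcendental_max_modulus_ge[OF assms(1), of 0] by blast
  have "c * r ^ n > 0" using nc assms by simp
  then show ?thesis using nc assms by (meson less_le_trans)
qed

lemma transcendental_max_modulus_ge_power:
  assumes "transcendental_entire h"
  shows "\<exists>R>0. \<forall>r\<ge>R. max_modulus r h \<ge> r ^ N"
proof -
  \<comment> \<open>The spare degree absorbs the constant, since \<open>c * r \<ge> 1\<close> for
    large \<open>r\<close>.\<close>
  obtain n c where nc: "n \<ge> Suc N" "c > 0" "\<forall>r>0. max_modulus r h \<ge> c * r ^ n"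
    using transcendental_max_modulus_ge[OF assms, of "Suc N"] by blast
  define R where "R = max 1 (1 / c)"
  have "max_modulus r h \<ge> r ^ N" if "r \<ge> R" for r
  proof -
    have r: "r \<ge> 1" "c * r \<ge> 1" using that nc by (auto simp: R_def field_simps)
    have "r ^ N \<le> (c * r) * r ^ N"
      using mult_right_mono[OF r(2), of "r ^ N"] r by simp
    also have "\<dots> = c * r ^ Suc N" by simp
    also have "\<dots> \<le> c * r ^ n" using nc r by (intro mult_left_mono power_increasing) auto
    also have "\<dots> \<le> max_modulus r h" using nc r by auto
    finally show ?thesis .
  qed
  moreover have "R > 0" by (simp add: R_def)
  ultimately show ?thesis by blast
qed

text \<open>In the coordinate \<open>x = ln r\<close> the three circles theorem becomes convexity,
  and the local growth of the maximum modulus becomes a question about slopes of a convex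
  function.\<close>

definition log_max_modulus :: "(complex \<Rightarrow> complex) \<Rightarrow> real \<Rightarrow> real" where
  "log_max_modulus h x = ln (max_modulus (exp x) h)"

lemma exp_log_max_modulus:
  assumes "transcendental_entire h"
  shows "exp (log_max_modulus h x) = max_modulus (exp x) h"
  using transcendental_max_modulus_pos[OF assms, of "exp x"] by (simp add: log_max_modulus_def)

lemma norm_exp_le_log_max_modulus:
  assumes "transcendental_entire h"
  shows "norm (h (exp s)) \<le> exp (log_max_modulus h (Re s))"
  using norm_le_max_modulus[OF transcendental_holomorphic[OF assms], of "exp s"]
  by (simp add: exp_log_max_modulus[OF assms])

lemma log_max_modulus_point:
  assumes "transcendental_entire h"
  obtains s where "Re s = x" "norm (h (exp s)) = exp (log_max_modulus h x)"
proof -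
  obtain z where z: "norm z = exp x" "norm (h z) = max_modulus (exp x) h"
    using max_modulus_point[OF transcendental_holomorphic[OF assms], of "exp x"] by auto
  have "z \<noteq> 0" using z(1) by auto
  then show thesis
    using that[of "Ln z"] z by (simp add: exp_log_max_modulus[OF assms])
qed

text \<open>Hadamard's three circles theorem. The function \<open>h (exp s) * exp (- l * s)\<close> on a vertical
  strip has \<open>2 * pi * \<i>\<close>-periodic modulus, so the maximum principle applies although the strip is
  unbounded.\<close>

lemma exp_strip_maximum:
  assumes h: "transcendental_entire h" and x: "x1 \<le> x" "x \<le> x2"
  shows "log_max_modulus h x - l * x
           \<le> max (log_max_modulus h x1 - l * x1) (log_max_modulus h x2 - l * x2)"
proof -
  define F where "F s = h (exp s) * exp (- (of_real l * s))" for s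
  note hol = transcendental_holomorphic[OF h]
  have holF: "F holomorphic_on UNIV"
    unfolding F_def
    by (intro holomorphic_intros holomorphic_on_compose_gen[OF _ hol, unfolded o_def]) auto
  have nF: "norm (F s) = norm (h (exp s)) * exp (- l * Re s)" for s
    by (simp add: F_def norm_mult)
  have leF: "norm (F s) \<le> exp (log_max_modulus h (Re s) - l * Re s)" for s
    using norm_exp_le_log_max_modulus[OF h, of s] by (simp add: nF exp_diff exp_minus field_simps)
  have attF: "\<exists>s. Re s = y \<and> norm (F s) = exp (log_max_modulus h y - l * y)" for y
    by (rule log_max_modulus_point[OF h, of y]) (auto simp: nF exp_diff exp_minus field_simps)
  define K where "K = cbox (Complex x1 (-pi)) (Complex x2 pi)"
  have K: "s \<in> K \<longleftrightarrow> x1 \<le> Re s \<and> Re s \<le> x2 \<and> \<bar>Im s\<bar> \<le> pi" for s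
    by (auto simp: K_def in_cbox_complex_iff)
  have "K \<noteq> {}" using K[of "Complex x 0"] x by auto
  then obtain s0 where s0: "s0 \<in> K" "\<And>s. s \<in> K \<Longrightarrow> norm (F s) \<le> norm (F s0)"
    using continuous_attains_sup[of K "\<lambda>s. norm (F s)"] entire_continuous_on[OF holF, of K]
    by (auto simp: K_def intro!: continuous_on_norm)
  have max0: "norm (F s) \<le> norm (F s0)" if "x1 \<le> Re s" "Re s \<le> x2" for s
  proof (cases "exp s = 0")
    case False
    define t where "t = Complex (Re s) (Im (Ln (exp s)))"
    have "exp t = exp s"
    proof -
      have "t = Ln (exp s)" using False by (simp add: t_def complex_eq_iff Re_Ln)
      then show ?thesis by simp
    qed
    then have "norm (F t) = norm (F s)" by (simp add: nF t_def)
    moreover have "t \<in> K"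
      using that mpi_less_Im_Ln[OF False] Im_Ln_le_pi[OF False] by (auto simp: K t_def)
    ultimately show ?thesis using s0(2)[of t] by simp
  qed auto
  obtain sx where sx: "Re sx = x" "norm (F sx) = exp (log_max_modulus h x - l * x)"
    using attF by blast
  have "norm (F sx) \<le> max (exp (log_max_modulus h x1 - l * x1)) (exp (log_max_modulus h x2 - l * x2))"
  proof (cases "Re s0 = x1 \<or> Re s0 = x2")
    case True
    then show ?thesis using max0[of sx] sx x leF[of s0] by auto
  next
    case False
    define U where "U = {s. x1 < Re s} \<inter> {s. Re s < x2}"
    have "F constant_on UNIV"
    proof (rule maximum_modulus_principle[OF holF])
      show "open U" by (auto simp: U_def open_halfspace_Re_gt open_halfspace_Re_lt)
      show "s0 \<in> U" using False s0(1) by (auto simp: U_def K)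
      show "norm (F z) \<le> norm (F s0)" if "z \<in> U" for z
        using that max0[of z] by (auto simp: U_def)
    qed auto
    then have "F sx = F (of_real x1)" by (auto simp: constant_on_def)
    then show ?thesis using leF[of "of_real x1"] by (simp add: le_max_iff_disj)
  qed
  then have "exp (log_max_modulus h x - l * x) \<le>
      exp (max (log_max_modulus h x1 - l * x1) (log_max_modulus h x2 - l * x2))"
    unfolding sx by (auto simp: max_def split: if_splits)
  then show ?thesis by simp
qed

lemma convex_log_max_modulus:
  assumes h: "transcendental_entire h"
  shows "convex_on UNIV (log_max_modulus h)"
proof (rule convex_onI)
  fix t x y :: real
  assume t: "0 < t" "t < 1"
  let ?B = "log_max_modulus h"
  have aux: "?B ((1 - t) * x + t * y) \<le> (1 - t) * ?B x + t * ?B y"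
    if t: "0 < t" "t < 1" and xy: "x < y" for t x y
  proof -
    \<comment> \<open>With the slope of the chord both entries of the maximum in
      \<open>exp_strip_maximum\<close> coincide, which turns the maximum principle into
      convexity.\<close>
    define l where "l = (?B y - ?B x) / (y - x)"
    define u where "u = (1 - t) * x + t * y"
    have ly: "l * (y - x) = ?B y - ?B x" using xy by (simp add: l_def)
    have ux: "u - x = t * (y - x)" by (simp add: u_def algebra_simps)
    have uy: "y - u = (1 - t) * (y - x)" by (simp add: u_def algebra_simps)
    have "0 \<le> t * (y - x)" "0 \<le> (1 - t) * (y - x)" using t xy by auto
    then have "x \<le> u" "u \<le> y" unfolding ux[symmetric] uy[symmetric] by simp_all
    then have "?B u - l * u \<le> max (?B x - l * x) (?B y - l * y)"
      by (rule exp_strip_maximum[OF h])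
    moreover have "?B x - l * x = ?B y - l * y" using ly by (simp add: algebra_simps)
    ultimately have "?B u \<le> ?B x + l * (u - x)" by (simp add: algebra_simps)
    also have "l * (u - x) = t * (?B y - ?B x)" using ly by (simp add: ux)
    finally show ?thesis by (simp add: u_def algebra_simps)
  qed
  consider "x < y" | "x = y" | "y < x" by linarith
  then show "?B ((1 - t) *\<^sub>R x + t *\<^sub>R y) \<le> (1 - t) * ?B x + t * ?B y"
  proof cases
    case 1 then show ?thesis using aux[OF t] by simp
  next
    case 2 then show ?thesis by (simp add: algebra_simps)
  next
    case 3
    then show ?thesis using aux[of "1 - t" y x] t by (simp add: algebra_simps)
  qed
qed auto

lemma log_max_modulus_superlinear:
  assumes h: "transcendental_entire h"
  shows "\<exists>X. \<forall>x\<ge>X. log_max_modulus h x \<ge> real N * x"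
proof -
  obtain R where R: "R > 0" "\<forall>r\<ge>R. max_modulus r h \<ge> r ^ N"
    using transcendental_max_modulus_ge_power[OF h] by blast
  have "log_max_modulus h x \<ge> real N * x" if "x \<ge> ln R" for x
  proof -
    have "exp x \<ge> R" using that R by (metis exp_le_cancel_iff exp_ln)
    then have "exp (real N * x) \<le> exp (log_max_modulus h x)"
      using R by (simp add: exp_of_nat_mult exp_log_max_modulus[OF h])
    then show ?thesis by simp
  qed
  then show ?thesis by blast
qed

subsection \<open>A growth lemma for convex functions\<close>

text \<open>A Borel-type growth lemma. If no suitable \<open>y\<close> existed beyond \<open>Y0\<close>, then from every point one
  could move right by at least \<open>1 / p y\<close> without increasing \<open>y + C / p y + 2 * exp (- B y)\<close>, which is
  absurd since \<open>p\<close> is locally bounded.\<close>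

lemma subgradient_regular_point:
  fixes B p :: "real \<Rightarrow> real"
  assumes sub: "\<And>x y. B y \<ge> B x + p x * (y - x)"
    and pos: "p Y0 > 0" and m: "m \<ge> 1" and dl: "\<delta> > 0"
  shows "\<exists>y\<ge>Y0. p (y + 2 * m / p y) \<le> (1 + \<delta>) * p y \<and> p y \<le> exp (B y)"
proof (rule ccontr)
  assume neg: "\<not> ?thesis"
  have mono: "p x \<le> p y" if "x \<le> y" for x y
  proof (cases "x = y")
    case False
    have "0 \<le> (p y - p x) * (y - x)" using sub[of x y] sub[of y x] by (simp add: algebra_simps)
    then show ?thesis using that False by (simp add: zero_le_mult_iff)
  qed auto
  have ppos: "p y > 0" if "y \<ge> Y0" for y using mono[OF that] pos by linarith
  have Bmono: "B x \<le> B y" if "Y0 \<le> x" "x \<le> y" for x y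
    using sub[of x y] ppos[OF that(1)] that by (smt (verit) mult_nonneg_nonneg)
  \<comment> \<open>Chosen so that \<open>C / p\<close> drops by \<open>2 * m / p\<close> when
    \<open>p\<close> is multiplied by \<open>1 + \<delta>\<close>; this pays for a step of that
    length.\<close>
  define C where "C = 2 * m * (1 + \<delta>) / \<delta>"
  have C: "C > 0" using m dl by (simp add: C_def)
  \<comment> \<open>The second term pays for the other kind of step: if
    \<open>p y > exp (B y)\<close>, moving by \<open>1 / p y\<close> raises \<open>B\<close> by at
    least 1, so \<open>2 * exp (- B y)\<close> falls by at least half, that is, by more than
    \<open>1 / p y\<close>.\<close>
  define \<Phi> where "\<Phi> y = C / p y + 2 * exp (- B y)" for y
  have step: "\<exists>y'\<ge>y + 1 / p y. y' + \<Phi> y' \<le> y + \<Phi> y" if y: "y \<ge> Y0" for y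
  proof (cases "p (y + 2 * m / p y) > (1 + \<delta>) * p y")
    case True
    define y' where "y' = y + 2 * m / p y"
    have yy: "y \<le> y'" using ppos[OF y] m by (simp add: y'_def)
    have "C / p y' \<le> C / ((1 + \<delta>) * p y)"
      using True ppos[OF y] ppos[of y'] yy y dl C
      by (intro divide_left_mono mult_pos_pos) (auto simp flip: y'_def)
    also have "\<dots> = 2 * m / (\<delta> * p y)" using dl by (simp add: C_def)
    also have "\<dots> = C / p y - 2 * m / p y"
      using ppos[OF y] dl by (simp add: C_def field_simps)
    finally have "C / p y' \<le> C / p y - 2 * m / p y" .
    moreover have "exp (- B y') \<le> exp (- B y)" using Bmono[OF y yy] by simp
    ultimately have "y' + \<Phi> y' \<le> y + \<Phi> y" unfolding \<Phi>_def using y'_def by linarith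
    moreover have "1 / p y \<le> 2 * m / p y" using m ppos[OF y] by (intro divide_right_mono) auto
    ultimately show ?thesis by (intro exI[of _ y']) (auto simp: y'_def)
  next
    case False
    then have big: "p y > exp (B y)" using neg y by force
    define y' where "y' = y + 1 / p y"
    have yy: "y \<le> y'" using ppos[OF y] by (simp add: y'_def)
    have "B y' \<ge> B y + 1" using sub[of y y'] ppos[OF y] by (simp add: y'_def)
    then have "exp (- B y') \<le> exp (- B y) * exp (-1)" by (simp flip: exp_add)
    also have "\<dots> \<le> exp (- B y) * (1/2)"
      using exp_ge_add_one_self[of 1] by (intro mult_left_mono) (auto simp: exp_minus field_simps)
    finally have "2 * exp (- B y') \<le> exp (- B y)" by simp
    moreover have "1 / p y \<le> exp (- B y)"
      using big ppos[OF y] by (simp add: exp_minus field_simps)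
    moreover have "C / p y' \<le> C / p y"
      using mono[OF yy] ppos[OF y] ppos[of y'] yy y C by (intro divide_left_mono) auto
    ultimately have "y' + \<Phi> y' \<le> y + \<Phi> y" unfolding \<Phi>_def using y'_def by linarith
    then show ?thesis by (intro exI[of _ y']) (auto simp: y'_def)
  qed
  define T where "T = Y0 + \<Phi> Y0"
  define A where "A = {y. y \<ge> Y0 \<and> y + \<Phi> y \<le> T}"
  have AT: "y \<le> T" if "y \<in> A" for y
  proof -
    have "\<Phi> y \<ge> 0" using that ppos[of y] C by (simp add: A_def \<Phi>_def)
    then show ?thesis using that by (simp add: A_def)
  qed
  have Y0A: "Y0 \<in> A" by (simp add: A_def T_def)
  have bdd: "bdd_above A" using AT by (auto simp: bdd_above_def)
  have pT: "p T > 0" using ppos AT[OF Y0A] by simp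
  \<comment> \<open>On \<open>A\<close> the slope is at most \<open>p T\<close>, so every step has
    length at least \<open>1 / p T\<close>; from a point this close to the supremum it leaves
    \<open>A\<close>.\<close>
  obtain y where y: "y \<in> A" "y > Sup A - 1 / p T"
    using less_cSup_iff[of A "Sup A - 1 / p T"] Y0A bdd pT by auto
  obtain y' where y': "y' \<ge> y + 1 / p y" "y' + \<Phi> y' \<le> y + \<Phi> y"
    using step[of y] y(1) by (auto simp: A_def)
  have py: "p y > 0" "p y \<le> p T" using ppos mono AT[OF y(1)] y(1) by (auto simp: A_def)
  then have "1 / p T \<le> 1 / p y" by (intro divide_left_mono) auto
  moreover have "y' \<in> A"
  proof -
    have "1 / p y > 0" using py by simp
    then show ?thesis using y' y(1) unfolding A_def mem_Collect_eq by linarith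
  qed
  then have "y' \<le> Sup A" using bdd by (simp add: cSup_upper)
  ultimately show False using y(2) y'(1) by linarith
qed

text \<open>\<open>subgradient_regular_point\<close> yields an interval on which the slope changes
  by a factor of at most \<open>1 + \<delta>\<close>; its midpoint has a two-sided window. The bound
  \<open>\<nu> \<le> 2 * exp (B x)\<close> later limits the normalising factor of \<open>f\<close>
  by the size of \<open>g z\<close>.\<close>

lemma convex_superlinear_regular_point:
  fixes B :: "real \<Rightarrow> real"
  assumes conv: "convex_on UNIV B"
    and sup: "\<And>N::nat. \<exists>X. \<forall>x\<ge>X. B x \<ge> real N * x"
    and m: "m \<ge> 1"
  shows "\<exists>x\<ge>X. \<exists>\<nu>\<ge>m. \<nu> \<le> 2 * exp (B x) \<and>
           (\<forall>\<sigma>. \<bar>\<sigma>\<bar> \<le> m \<longrightarrow> B (x + \<sigma> / \<nu>) \<le> B x + \<sigma> + 1 / m)"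
proof -
  \<comment> \<open>The right derivative of \<open>B\<close>, used as a subgradient.\<close>
  define p where "p x = Inf ((\<lambda>t. (B x - B t) / (x - t)) ` ({x<..} \<inter> UNIV))" for x
  have sub: "B y \<ge> B x + p x * (y - x)" for x y
    unfolding p_def using convex_le_Inf_differential[OF conv, of x y] by simp
  have mono: "p x \<le> p y" if "x \<le> y" for x y
  proof (cases "x = y")
    case False
    have "0 \<le> (p y - p x) * (y - x)" using sub[of x y] sub[of y x] by (simp add: algebra_simps)
    then show ?thesis using that False by (simp add: zero_le_mult_iff)
  qed auto
  obtain N :: nat where N: "real N \<ge> m + 1" using real_arch_simple by blast
  obtain X1 where X1: "\<And>x. x \<ge> X1 \<Longrightarrow> B x \<ge> real N * x" using sup by blast
  \<comment> \<open>The subgradient inequality at \<open>Y0\<close>, tested at 0, bounds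
    \<open>p Y0\<close> from below; one unit of the slope \<open>m + 1\<close> is spent on
    \<open>B 0\<close>.\<close>
  define Y0 where "Y0 = Max {X, X1, 1, B 0}"
  have Y0: "Y0 \<ge> X" "Y0 \<ge> X1" "Y0 \<ge> 1" "Y0 \<ge> B 0" by (auto simp: Y0_def)
  have pY0: "p Y0 \<ge> m"
  proof -
    have "(m + 1) * Y0 \<le> real N * Y0" using N Y0 by (intro mult_right_mono) auto
    also have "\<dots> \<le> B Y0" using X1 Y0 by simp
    also have "\<dots> \<le> B 0 + p Y0 * Y0" using sub[of Y0 0] by simp
    finally have "m * Y0 + Y0 \<le> B 0 + p Y0 * Y0" by (simp add: distrib_right)
    then have "m * Y0 \<le> p Y0 * Y0" using Y0(4) by linarith
    then show ?thesis using Y0(3) by simp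
  qed
  \<comment> \<open>The slope error accumulated over a window of length \<open>m\<close> is then
    \<open>\<delta> * m = 1 / m\<close>.\<close>
  define \<delta> where "\<delta> = 1 / m\<^sup>2"
  have dl: "\<delta> > 0" "\<delta> \<le> 1" "\<delta> * m = 1 / m"
    using m by (auto simp: \<delta>_def power2_eq_square mult_ge1_I)
  obtain y where y: "y \<ge> Y0" "p (y + 2 * m / p y) \<le> (1 + \<delta>) * p y" "p y \<le> exp (B y)"
    using subgradient_regular_point[OF sub _ m dl(1), of Y0] pY0 m by force
  have py: "p y \<ge> m" using mono[OF y(1)] pY0 by linarith
  define x where "x = y + m / p y"
  have xy: "x \<ge> y" using py m by (simp add: x_def)
  have px: "p x \<ge> p y" using mono[OF xy] .
  have mm: "m / p x \<le> m / p y" using px py m by (intro divide_left_mono) auto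
  have range: "y \<le> x + \<sigma> / p x \<and> x + \<sigma> / p x \<le> y + 2 * m / p y" if "\<bar>\<sigma>\<bar> \<le> m" for \<sigma>
  proof -
    have "\<bar>\<sigma> / p x\<bar> \<le> m / p x" using that px py m by (simp add: divide_right_mono)
    then have "\<bar>\<sigma> / p x\<bar> \<le> m / p y" using mm by linarith
    moreover have "2 * m / p y = m / p y + m / p y" by simp
    ultimately show ?thesis using x_def by linarith
  qed
  have "p (x + 0 / p x) \<le> p (y + 2 * m / p y)" using range[of 0] m by (intro mono) auto
  then have px2: "p x \<le> (1 + \<delta>) * p y" using y(2) by simp
  have "B (x + \<sigma> / p x) \<le> B x + \<sigma> + 1 / m" if s: "\<bar>\<sigma>\<bar> \<le> m" for \<sigma>
  proof -
    define u where "u = x + \<sigma> / p x"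
    have pu: "p y \<le> p u" "p u \<le> (1 + \<delta>) * p y"
      using mono[of y u] mono[of u "y + 2 * m / p y"] range[OF s] y(2) by (auto simp: u_def)
    \<comment> \<open>The subgradient is taken at \<open>u\<close>, not at \<open>x\<close>: this
      direction of convexity bounds \<open>B u\<close> from above.\<close>
    have "B u \<le> B x + p u * (\<sigma> / p x)" using sub[of u x] by (simp add: u_def)
    also have "p u * (\<sigma> / p x) \<le> \<sigma> + \<delta> * m"
    proof (cases "\<sigma> \<ge> 0")
      case True
      have "p u \<le> (1 + \<delta>) * p x"
        using pu(2) px dl by (smt (verit) mult_left_mono)
      then have "p u * (\<sigma> / p x) \<le> ((1 + \<delta>) * p x) * (\<sigma> / p x)"
        using True px py m by (intro mult_right_mono) auto
      also have "\<dots> = \<sigma> + \<delta> * \<sigma>" using px py m by (simp add: field_simps)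
      also have "\<dots> \<le> \<sigma> + \<delta> * m" using s dl(1) by (intro add_left_mono mult_left_mono) auto
      finally show ?thesis .
    next
      case False
      have "(1 - \<delta>) * p x \<le> (1 - \<delta>) * ((1 + \<delta>) * p y)" using px2 dl by (intro mult_left_mono) auto
      also have "\<dots> = p y - \<delta>\<^sup>2 * p y" by (simp add: algebra_simps power2_eq_square)
      also have "\<dots> \<le> p u" using pu py m by (smt (verit) mult_nonneg_nonneg zero_le_power2)
      finally have "p u * (- \<sigma> / p x) \<ge> ((1 - \<delta>) * p x) * (- \<sigma> / p x)"
        using False px py m by (intro mult_right_mono divide_nonneg_pos) auto
      then have "p u * (\<sigma> / p x) \<le> ((1 - \<delta>) * p x) * (\<sigma> / p x)" by simp
      also have "\<dots> = \<sigma> + \<delta> * (- \<sigma>)" using px py m by (simp add: field_simps)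
      also have "\<delta> * (- \<sigma>) \<le> \<delta> * m" using s dl by (intro mult_left_mono) auto
      finally show ?thesis by simp
    qed
    finally show ?thesis using dl(3) by (simp add: u_def)
  qed
  moreover have "p x \<le> 2 * exp (B x)"
  proof -
    have "B y \<le> B x" using sub[of y x] xy py m by (smt (verit) mult_nonneg_nonneg)
    then have "exp (B y) \<le> exp (B x)" by simp
    moreover have "(1 + \<delta>) * p y \<le> 2 * p y" using dl py m by (intro mult_right_mono) auto
    ultimately show ?thesis using px2 y(3) by linarith
  qed
  moreover have "p x \<ge> m" "x \<ge> X" using px py xy y(1) Y0 by linarith+
  ultimately show ?thesis by blast
qed

subsection \<open>Local exponential behaviour\<close>

lemma norm_deriv_le_of_bound:
  fixes h :: "complex \<Rightarrow> complex"
  assumes hol: "h holomorphic_on A" and cb: "cball s 1 \<subseteq> A"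
    and bd: "\<And>x. x \<in> A \<Longrightarrow> norm (h x) \<le> e"
  shows "norm (deriv h s) \<le> e"
proof -
  have "norm ((deriv ^^ 1) h s) \<le> fact 1 * e / 1 ^ 1"
  proof (rule Cauchy_inequality)
    show "h holomorphic_on ball s 1"
      using cb by (intro holomorphic_on_subset[OF hol]) (auto simp: subset_eq)
    show "continuous_on (cball s 1) h"
      using holomorphic_on_imp_continuous_on[OF hol] cb continuous_on_subset by blast
    show "norm (h x) \<le> e" if "norm (s - x) = 1" for x
      using cb that by (intro bd) (auto simp: subset_eq dist_norm)
  qed auto
  then show ?thesis by simp
qed

text \<open>Cauchy's estimate makes \<eta> a contraction, hence \<open>s + \<eta> s\<close> is
  injective; Brouwer's theorem for \<open>S - \<eta> x\<close> gives the values. Of the two extra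
  units of radius, one is for Cauchy's estimate and one for the displacement of the inverse.\<close>

lemma perturbed_identity_inverse:
  fixes \<eta> :: "complex \<Rightarrow> complex"
  assumes hol: "\<eta> holomorphic_on ball 0 (m + 2)" and m: "m > 0"
    and e: "0 < e" "e \<le> 1/4"
    and bd: "\<And>s. s \<in> ball 0 (m + 2) \<Longrightarrow> norm (\<eta> s) \<le> e"
  shows "\<exists>\<theta>. \<theta> holomorphic_on ball 0 m \<and>
          (\<forall>S\<in>ball 0 m. norm (\<theta> S - S) \<le> e \<and> \<theta> S \<in> ball 0 (m + 1) \<and> \<theta> S + \<eta> (\<theta> S) = S)"
proof -
  define h where "h s = s + \<eta> s" for s
  define D where "D = ball (0::complex) (m + 1)"
  have sub: "D \<subseteq> ball 0 (m + 2)" by (auto simp: D_def)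
  note holD = holomorphic_on_subset[OF hol sub]
  have der: "norm (deriv \<eta> s) \<le> e" if "s \<in> D" for s
  proof -
    have cb: "cball s 1 \<subseteq> ball 0 (m + 2)"
    proof
      fix x assume "x \<in> cball s 1"
      then show "x \<in> ball 0 (m + 2)"
        using that norm_triangle_ineq2[of x s] by (simp add: D_def dist_norm norm_minus_commute)
    qed
    show ?thesis by (rule norm_deriv_le_of_bound[OF hol cb bd])
  qed
  have lip: "norm (\<eta> x - \<eta> y) \<le> 1/4 * norm (x - y)" if "x \<in> D" "y \<in> D" for x y
  proof -
    have "norm (\<eta> x - \<eta> y) \<le> e * norm (x - y)"
    proof (rule field_differentiable_bound[of D \<eta> "deriv \<eta>"])
      show "(\<eta> has_field_derivative deriv \<eta> z) (at z within D)" if "z \<in> D" for z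
        using holomorphic_derivI[OF holD _ that] has_field_derivative_at_within by (auto simp: D_def)
    qed (use that der in \<open>auto simp: D_def\<close>)
    also have "\<dots> \<le> 1/4 * norm (x - y)" using e by (intro mult_right_mono) auto
    finally show ?thesis .
  qed
  have inj: "inj_on h D"
  proof (rule inj_onI)
    fix x y assume xy: "x \<in> D" "y \<in> D" "h x = h y"
    then have "x - y = \<eta> y - \<eta> x" by (simp add: h_def algebra_simps)
    then have "norm (x - y) \<le> 1/4 * norm (x - y)" using lip[OF xy(2,1)] by (simp add: norm_minus_commute)
    then show "x = y" by simp
  qed
  have surj: "\<exists>s\<in>D. h s = S" if S: "S \<in> ball 0 m" for S
  proof -
    have sb: "cball 0 (m + 1/2) \<subseteq> D" by (auto simp: D_def)
    have "\<exists>x\<in>cball 0 (m + 1/2). S - \<eta> x = x"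
    proof (rule brouwer_ball)
      show "continuous_on (cball 0 (m + 1/2)) (\<lambda>x. S - \<eta> x)"
        using holomorphic_on_imp_continuous_on[OF holD] sb
        by (intro continuous_intros) (auto intro: continuous_on_subset)
      show "(\<lambda>x. S - \<eta> x) \<in> cball 0 (m + 1/2) \<rightarrow> cball 0 (m + 1/2)"
      proof
        fix x :: complex assume "x \<in> cball 0 (m + 1/2)"
        then have "norm (\<eta> x) \<le> e" using sb sub by (intro bd) auto
        then show "S - \<eta> x \<in> cball 0 (m + 1/2)"
          using norm_triangle_ineq4[of S "\<eta> x"] S e by simp
      qed
    qed (use m in auto)
    then show ?thesis using sb by (force simp: h_def algebra_simps)
  qed
  have holh: "h holomorphic_on D" unfolding h_def by (intro holomorphic_intros holD)
  obtain \<theta> where \<theta>: "\<theta> holomorphic_on (h ` D)" "\<And>z. z \<in> D \<Longrightarrow> \<theta> (h z) = z"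
    using holomorphic_has_inverse[OF holh _ inj] by (metis D_def open_ball)
  have "\<theta> holomorphic_on ball 0 m"
    using surj by (intro holomorphic_on_subset[OF \<theta>(1)]) force
  moreover have "norm (\<theta> S - S) \<le> e \<and> \<theta> S \<in> ball 0 (m + 1) \<and> \<theta> S + \<eta> (\<theta> S) = S"
    if S: "S \<in> ball 0 m" for S
  proof -
    obtain s where s: "s \<in> D" "h s = S" using surj[OF S] by blast
    then have "\<theta> S = s" using \<theta>(2) by blast
    moreover have "norm (s - S) = norm (\<eta> s)" unfolding s(2)[symmetric] h_def by simp
    ultimately show ?thesis using s bd[of s] sub by (auto simp: D_def h_def)
  qed
  ultimately show ?thesis by blast
qed

text \<open>A substitute for the Wiman--Valiron theorem. At a point \<open>x\<close> where the convex function
  \<open>log_max_modulus g\<close> is almost linear on the scale \<open>1 / \<nu>\<close>, the quotient of \<open>g (z * exp (s / \<nu>))\<close> by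
  \<open>g z * exp s\<close> is bounded by a constant, hence close to its value \<open>1\<close> at \<open>s = 0\<close> by the Schwarz
  lemma.\<close>

lemma exponential_behaviour_near_maximum:
  assumes g: "transcendental_entire g" and m: "m \<ge> 1"
  shows "\<exists>z \<nu> \<theta>. norm z \<ge> X \<and> z \<noteq> 0 \<and> norm z \<le> norm (g z) \<and> m\<^sup>2 \<le> \<nu> \<and> \<nu> \<le> 2 * norm (g z) \<and>
           \<theta> holomorphic_on ball 0 m \<and>
           (\<forall>S\<in>ball 0 m. norm (\<theta> S - S) \<le> 1 / m \<and> g (z * exp (\<theta> S / of_real \<nu>)) = g z * exp S) \<and>
           (\<forall>\<sigma>. \<bar>\<sigma>\<bar> \<le> m + 1 \<longrightarrow>
              max_modulus (norm z * exp (\<sigma> / \<nu>)) g \<le> norm (g z) * exp (\<sigma> + 1 / m))"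
proof -
  note hol = transcendental_holomorphic[OF g]
  define B where "B = log_max_modulus g"
  \<comment> \<open>The Schwarz lemma on the disc of radius \<open>n\<close> with bound 5 gives
    \<open>norm (H s - 1) \<le> 5 * (m + 2) / n\<close>, which this choice makes
    \<open>1 / (8 * m)\<close>.\<close>
  define n where "n = 40 * m * (m + 2)"
  have n: "n \<ge> m + 2" "n \<ge> m\<^sup>2" "n \<ge> 1"
  proof -
    have "1 * (m + 2) \<le> 40 * m * (m + 2)" using m by (intro mult_right_mono) auto
    then show "n \<ge> m + 2" by (simp add: n_def)
    then show "n \<ge> 1" using m by simp
    have "m * m \<le> 40 * m * (m + 2)" using m by (intro mult_mono) auto
    then show "n \<ge> m\<^sup>2" by (simp add: n_def power2_eq_square)
  qed
  obtain X1 where X1: "\<And>x. x \<ge> X1 \<Longrightarrow> B x \<ge> real 1 * x"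
    using log_max_modulus_superlinear[OF g, of 1] by (auto simp: B_def)
  obtain x \<nu> where x: "x \<ge> max X1 (ln (max X 1))" and nu: "\<nu> \<ge> n" "\<nu> \<le> 2 * exp (B x)"
    and reg: "\<And>\<sigma>. \<bar>\<sigma>\<bar> \<le> n \<Longrightarrow> B (x + \<sigma> / \<nu>) \<le> B x + \<sigma> + 1 / n"
    using convex_superlinear_regular_point[OF convex_log_max_modulus[OF g]
        log_max_modulus_superlinear[OF g] n(3), folded B_def] by metis
  obtain s0 where s0: "Re s0 = x" "norm (g (exp s0)) = exp (B x)"
    using log_max_modulus_point[OF g, of x] by (auto simp: B_def)
  define z where "z = exp s0"
  have nz: "norm z = exp x" by (simp add: z_def s0)
  have gz: "norm (g z) = exp (B x)" by (simp add: z_def s0)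
  have gz0: "g z \<noteq> 0" using gz by auto
  have nu0: "\<nu> > 0" using nu n by linarith
  define H where "H s = g (z * exp (s / of_real \<nu>)) / g z * exp (- s)" for s
  have holH: "H holomorphic_on UNIV" unfolding H_def
    by (intro holomorphic_intros holomorphic_on_compose_gen[OF _ hol, unfolded o_def])
       (use gz0 nu0 in auto)
  have maxb: "max_modulus (norm z * exp (\<sigma> / \<nu>)) g \<le> norm (g z) * exp (\<sigma> + 1 / n)"
    if "\<bar>\<sigma>\<bar> \<le> n" for \<sigma>
  proof -
    have "max_modulus (norm z * exp (\<sigma> / \<nu>)) g = exp (B (x + \<sigma> / \<nu>))"
      by (simp add: nz B_def exp_log_max_modulus[OF g] exp_add)
    also have "\<dots> \<le> exp (B x + \<sigma> + 1 / n)" using reg[OF that] by simp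
    finally show ?thesis by (simp add: gz exp_add mult.assoc)
  qed
  have H5: "norm (H s - 1) < 5" if s: "norm s < n" for s
  proof -
    have "\<bar>Re s\<bar> \<le> n" using abs_Re_le_cmod[of s] s by linarith
    then have "norm (g (z * exp (s / of_real \<nu>))) \<le> norm (g z) * exp (Re s + 1 / n)"
      using maxb[of "Re s"] norm_le_max_modulus[OF hol, of "z * exp (s / of_real \<nu>)"]
      by (simp add: norm_mult)
    then have "norm (H s) \<le> exp (Re s + 1 / n) * exp (- Re s)"
      using gz0 by (simp add: H_def norm_mult norm_divide divide_simps mult.commute)
    also have "\<dots> = exp (1 / n)" by (simp add: exp_add exp_minus)
    also have "\<dots> \<le> exp 1" using n by simp
    also have "\<dots> < 4" using exp_le by linarith
    finally show ?thesis using norm_triangle_ineq4[of "H s" 1] by simp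
  qed
  have small: "norm (H s - 1) \<le> 1 / (8 * m)" if s: "norm s < m + 2" for s
  proof -
    define F where "F t = (H (of_real n * t) - 1) / 5" for t
    have "norm (F (s / of_real n)) \<le> norm (s / of_real n)"
    proof (rule Schwarz_Lemma(1))
      show "F holomorphic_on ball 0 1" unfolding F_def
        by (intro holomorphic_intros holomorphic_on_compose_gen[OF _ holH, unfolded o_def]) auto
      show "F 0 = 0" using gz0 by (simp add: F_def H_def)
      show "norm (F t) < 1" if "norm t < 1" for t
        using H5[of "of_real n * t"] that n by (simp add: F_def norm_divide norm_mult)
      show "norm (s / of_real n) < 1" using s n by (simp add: norm_divide)
    qed
    then have "norm (H s - 1) \<le> 5 * norm s / n"
      using n by (simp add: F_def norm_divide field_simps)
    also have "\<dots> \<le> 5 * (m + 2) / n" using s n by (intro divide_right_mono) auto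
    also have "n = (8 * m) * (5 * (m + 2))" by (simp add: n_def)
    also have "5 * (m + 2) / \<dots> = 1 / (8 * m)" using m by simp
    finally show ?thesis .
  qed
  \<comment> \<open>Since \<open>H = exp \<eta>\<close>, one has
    \<open>g (z * exp (s / \<nu>)) = g z * exp (s + \<eta> s)\<close>. Inverting
    \<open>s + \<eta> s\<close> makes the exponential law exact in the new variable
    \<open>S\<close>.\<close>
  define \<eta> where "\<eta> s = Ln (1 + (H s - 1))" for s
  have lt: "norm (H s - 1) < 1/2" if "norm s < m + 2" for s
  proof -
    have "1 / (8 * m) \<le> 1 / 8" using m by simp
    then show ?thesis using small[OF that] by linarith
  qed
  have RH: "Re (H s) > 0" if "norm s < m + 2" for s
    using lt[OF that] abs_Re_le_cmod[of "H s - 1"] by simp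
  have "\<exists>\<theta>. \<theta> holomorphic_on ball 0 m \<and>
     (\<forall>S\<in>ball 0 m. norm (\<theta> S - S) \<le> 1 / (4 * m) \<and> \<theta> S \<in> ball 0 (m + 1) \<and> \<theta> S + \<eta> (\<theta> S) = S)"
  proof (rule perturbed_identity_inverse)
    show "\<eta> holomorphic_on ball 0 (m + 2)" unfolding \<eta>_def
      by (intro holomorphic_intros holomorphic_on_subset[OF holH])
         (use RH in \<open>auto simp: complex_nonpos_Reals_iff not_le dest!: RH\<close>)
    show "norm (\<eta> s) \<le> 1 / (4 * m)" if "s \<in> ball 0 (m + 2)" for s
      using norm_Ln_le[of "H s - 1"] lt[of s] small[of s] that by (simp add: \<eta>_def)
  qed (use m in auto)
  then obtain \<theta> where \<theta>: "\<theta> holomorphic_on ball 0 m"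
    "\<And>S. S \<in> ball 0 m \<Longrightarrow> norm (\<theta> S - S) \<le> 1 / (4 * m) \<and> \<theta> S \<in> ball 0 (m + 1) \<and> \<theta> S + \<eta> (\<theta> S) = S"
    by blast
  have th: "norm (\<theta> S - S) \<le> 1 / m \<and> g (z * exp (\<theta> S / of_real \<nu>)) = g z * exp S"
    if S: "S \<in> ball 0 m" for S
  proof
    have "1 / (4 * m) \<le> 1 / m" using m by (intro divide_left_mono) auto
    then show "norm (\<theta> S - S) \<le> 1 / m" using \<theta>(2)[OF S] by linarith
    define s where "s = \<theta> S"
    have s: "norm s < m + 2" "s + \<eta> s = S" using \<theta>(2)[OF S] by (auto simp: s_def)
    have "H s \<noteq> 0" using RH[OF s(1)] by auto
    then have "exp (\<eta> s) = H s" by (simp add: \<eta>_def)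
    then have "exp S = exp s * H s" using s(2) by (metis exp_add)
    then show "g (z * exp (\<theta> S / of_real \<nu>)) = g z * exp S"
      unfolding s_def[symmetric] using gz0 by (simp add: H_def exp_minus)
  qed
  have X: "norm z \<ge> X"
  proof -
    have "exp (ln (max X 1)) \<le> exp x" using x by (simp only: exp_le_cancel_iff max.bounded_iff)
    then have "max X 1 \<le> exp x" by (simp add: exp_ln)
    then show ?thesis by (simp add: nz)
  qed
  have zg: "norm z \<le> norm (g z)" using X1[of x] x by (simp add: nz gz)
  have mx: "max_modulus (norm z * exp (\<sigma> / \<nu>)) g \<le> norm (g z) * exp (\<sigma> + 1 / m)"
    if "\<bar>\<sigma>\<bar> \<le> m + 1" for \<sigma>
  proof -
    have "1 / n \<le> 1 / m" using n m by (intro divide_left_mono) auto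
    then have "norm (g z) * exp (\<sigma> + 1 / n) \<le> norm (g z) * exp (\<sigma> + 1 / m)"
      by (intro mult_left_mono) auto
    then show ?thesis using maxb[of \<sigma>] that n by linarith
  qed
  have nu2: "m\<^sup>2 \<le> \<nu>" "\<nu> \<le> 2 * norm (g z)" using n nu gz by auto
  show ?thesis
    using X zg nu2 \<theta>(1) th mx by (intro exI[of _ z] exI[of _ \<nu>] exI[of _ \<theta>]) (auto simp: z_def)
qed

subsection \<open>Rescaling at the unit level\<close>

text \<open>A logarithm of \<open>k\<close> maps into the right half-plane, and a Cayley transform reduces Harnack's
  inequality for \<open>ln \<bar>k\<bar>\<close> to the Schwarz lemma.\<close>

lemma harnack_ln_norm:
  assumes hol: "k holomorphic_on ball p d" and d: "d > 0"
    and gt: "\<And>z. z \<in> ball p d \<Longrightarrow> norm (k z) > 1"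
    and z: "z \<in> ball p d"
  shows "ln (norm (k z)) \<ge> ln (norm (k p)) * (d - dist p z) / (d + dist p z)"
proof -
  have "\<exists>H. H holomorphic_on ball p d \<and> (\<forall>x\<in>ball p d. k x = exp (H x))"
    using holomorphic_logarithm_exists[of "ball p d" k p] hol gt d
    by (metis convex_ball open_ball centre_in_ball norm_zero not_one_less_zero)
  then obtain H where H: "H holomorphic_on ball p d" "\<And>x. x \<in> ball p d \<Longrightarrow> k x = exp (H x)"
    by blast
  have ReH: "Re (H x) = ln (norm (k x))" if "x \<in> ball p d" for x
    using H(2)[OF that] by simp
  have ReH0: "Re (H x) > 0" if "x \<in> ball p d" for x
    using ReH[OF that] ln_gt_zero[OF gt[OF that]] by simp
  define a where "a = H p"
  have a: "Re a > 0" using ReH0[of p] d by (simp add: a_def)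
  define F where "F w = (H w - a) / (H w + cnj a)" for w
  have den: "H w + cnj a \<noteq> 0" if "w \<in> ball p d" for w
    using ReH0[OF that] a by (auto simp: complex_eq_iff)
  have less: "norm (h - a) < norm (h + cnj a)" if "Re h > 0" for h
  proof -
    have "(norm (h + cnj a))\<^sup>2 - (norm (h - a))\<^sup>2 = 4 * Re h * Re a"
      by (simp add: cmod_power2) (simp add: power2_eq_square algebra_simps)
    also have "\<dots> > 0" using that a by simp
    finally show ?thesis by (simp add: power2_less_imp_less)
  qed
  have F1: "norm (F w) < 1" if "w \<in> ball p d" for w
    using less[OF ReH0[OF that]] den[OF that] by (simp add: F_def norm_divide)
  define G where "G t = F (p + of_real d * t)" for t
  have inb: "p + of_real d * t \<in> ball p d" if "norm t < 1" for t
    using that d by (simp add: dist_norm norm_mult)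
  define t where "t = (z - p) / of_real d"
  have tn: "norm t = dist p z / d" using d by (simp add: t_def norm_divide dist_norm norm_minus_commute)
  have pt: "p + of_real d * t = z" using d by (simp add: t_def)
  have "norm (G t) \<le> norm t"
  proof (rule Schwarz_Lemma(1))
    have "F holomorphic_on ball p d"
      unfolding F_def by (intro holomorphic_intros H den)
    then show "G holomorphic_on ball 0 1"
      unfolding G_def
      by (intro holomorphic_on_compose_gen[of "\<lambda>t. p + of_real d * t" _ F "ball p d", unfolded o_def])
         (auto intro!: holomorphic_intros inb)
    show "G 0 = 0" by (simp add: G_def F_def a_def)
    show "norm (G w) < 1" if "norm w < 1" for w
      using F1[OF inb[OF that]] by (simp add: G_def)
    show "norm t < 1" using z d by (simp add: tn)
  qed
  then have "norm (F z) \<le> dist p z / d" by (simp add: G_def pt tn)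
  then have "norm (H z - a) * d \<le> dist p z * norm (H z + cnj a)"
    using den[OF z] d by (simp add: F_def norm_divide field_simps)
  then have le: "norm (H z - a) \<le> q * norm (H z + cnj a)" if "q = dist p z / d" for q
    using d that by (simp add: pos_le_divide_eq)
  define q where "q = dist p z / d"
  have q: "0 \<le> q" "q < 1" using z d by (auto simp: q_def)
  define u v where "u = Re (H z)" and "v = Re a"
  have uv: "u > 0" "v > 0" using ReH0[OF z] a by (auto simp: u_def v_def)
  define m where "m = (Im (H z) - Im a)\<^sup>2"
  have "(norm (H z - a))\<^sup>2 \<le> q\<^sup>2 * (norm (H z + cnj a))\<^sup>2"
    using power_mono[OF le[OF q_def], of 2] by (simp add: power_mult_distrib)
  then have "(u - v)\<^sup>2 + m \<le> q\<^sup>2 * ((u + v)\<^sup>2 + m)"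
    by (simp add: cmod_power2 u_def v_def m_def)
  moreover have "q\<^sup>2 * m \<le> m"
    using q by (simp add: m_def mult_left_le_one_le power_le_one)
  ultimately have "(u - v)\<^sup>2 \<le> (q * (u + v))\<^sup>2"
    unfolding power_mult_distrib by (simp only: distrib_left)
  then have "\<bar>u - v\<bar> \<le> q * (u + v)"
    using q uv by (metis abs_le_square_iff abs_of_nonneg add_nonneg_nonneg less_imp_le mult_nonneg_nonneg)
  then have "v * (1 - q) \<le> u * (1 + q)" by (simp add: algebra_simps abs_le_iff)
  then have "v * (d - dist p z) \<le> u * (d + dist p z)"
    using mult_right_mono[of "v * (1 - q)" "u * (1 + q)" d] d
    by (simp add: q_def algebra_simps)
  moreover have "d + dist p z > 0" using d by (simp add: add_pos_nonneg)
  ultimately have "v * (d - dist p z) / (d + dist p z) \<le> u" by (simp add: pos_divide_le_eq)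
  then show ?thesis using ReH[OF z] ReH[of p] d by (simp add: u_def v_def a_def)
qed

text \<open>The Clunie--Hayman argument: on the largest disc about \<open>p\<close> where \<open>\<bar>k\<bar> > 1\<close>, Harnack's
  inequality forces \<open>ln \<bar>k\<bar>\<close> to grow linearly away from the boundary point where \<open>\<bar>k\<bar> = 1\<close>.\<close>

lemma large_deriv_on_unit_level:
  assumes hol: "k holomorphic_on UNIV" and p: "norm (k p) > 1" and q: "norm (k q) \<le> 1"
  shows "\<exists>c. dist p c \<le> dist p q \<and> norm (k c) = 1 \<and>
             norm (deriv k c) \<ge> ln (norm (k p)) / (2 * dist p q)"
proof -
  note cont = entire_continuous_on[OF hol]
  define X where "X = {z. norm (k z) \<le> 1}"
  have clX: "closed X" unfolding X_def
    by (intro closed_Collect_le continuous_on_norm cont continuous_on_const)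
  have qX: "q \<in> X" using q by (simp add: X_def)
  obtain c where c: "c \<in> X" "\<And>y. y \<in> X \<Longrightarrow> dist p c \<le> dist p y"
    using distance_attains_inf[OF clX, of p] qX by blast
  define d where "d = dist p c"
  have pc: "p \<noteq> c" using p c(1) by (auto simp: X_def)
  have d: "d > 0" using pc by (simp add: d_def)
  have dq: "d \<le> dist p q" using c(2)[OF qX] by (simp add: d_def)
  have gt: "norm (k z) > 1" if "z \<in> ball p d" for z
    using that c(2)[of z] by (force simp: X_def d_def)
  define L where "L = ln (norm (k p))"
  have L: "L > 0" using ln_gt_zero[OF p] by (simp add: L_def)
  define u where "u = (p - c) / of_real d"
  have nu: "norm u = 1" using d by (simp add: u_def norm_divide d_def dist_norm)
  \<comment> \<open>At distance \<open>t\<close> from \<open>c\<close> Harnack's factor is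
    \<open>t / (2 * d - t)\<close>, at least \<open>t / (2 * d)\<close>; then
    \<open>ln x \<le> x - 1\<close> passes from the logarithm to \<open>norm (k z)\<close>.\<close>
  have low: "norm (k (c + of_real t * u)) \<ge> 1 + L / (2 * d) * t" if t: "0 < t" "t < d" for t
  proof -
    define z where "z = c + of_real t * u"
    have "p - z = of_real (d - t) * u" using d by (simp add: z_def u_def field_simps)
    then have dz: "dist p z = d - t" using t by (simp add: dist_norm norm_mult nu flip: of_real_diff)
    have "ln (norm (k z)) \<ge> L * (d - dist p z) / (d + dist p z)"
      unfolding L_def
      by (rule harnack_ln_norm[OF holomorphic_on_subset[OF hol] d gt]) (use t dz in auto)
    moreover have "L * (d - dist p z) / (d + dist p z) \<ge> L * t / (2 * d)"
      using t L d dz by (auto intro!: divide_left_mono mult_pos_pos)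
    ultimately have "L / (2 * d) * t \<le> ln (norm (k z))" by simp
    moreover have "norm (k z) > 1" using gt[of z] t dz by simp
    ultimately show ?thesis
      using ln_le_minus_one[of "norm (k z)"] unfolding z_def by linarith
  qed
  have lim: "((\<lambda>t. c + of_real t * u) \<longlongrightarrow> c) (at_right (0::real))"
    by (rule tendsto_eq_intros | simp)+
  have kc: "(k \<longlongrightarrow> k c) (at c)"
    using cont[of UNIV] by (simp add: continuous_on_eq_continuous_at isCont_def)
  have ev: "eventually (\<lambda>t. 0 < t \<and> t < d) (at_right (0::real))"
    using d eventually_at_right_less eventually_at_right[of 0 d] by (auto simp: eventually_at_right_field)
  have limat: "filterlim (\<lambda>t. c + of_real t * u) (at c) (at_right (0::real))"
    unfolding filterlim_at
    using lim nu by (auto intro!: eventually_mono[OF ev])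
  have "((\<lambda>t. norm (k (c + of_real t * u))) \<longlongrightarrow> norm (k c)) (at_right (0::real))"
    by (intro tendsto_norm filterlim_compose[OF kc limat])
  then have "1 \<le> norm (k c)"
  proof (rule tendsto_lowerbound)
    show "\<forall>\<^sub>F t in at_right (0::real). 1 \<le> norm (k (c + of_real t * u))"
      using ev
    proof eventually_elim
      case (elim t)
      then have "L / (2 * d) * t \<ge> 0" using L d by simp
      then show ?case using low[of t] elim by linarith
    qed
  qed simp
  then have k1: "norm (k c) = 1" using c(1) by (simp add: X_def)
  have der: "((\<lambda>z. (k z - k c) / (z - c)) \<longlongrightarrow> deriv k c) (at c)"
    using holomorphic_derivI[OF hol open_UNIV, of c] by (simp add: has_field_derivative_iff)
  have "((\<lambda>t. norm ((k (c + of_real t * u) - k c) / ((c + of_real t * u) - c)))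
          \<longlongrightarrow> norm (deriv k c)) (at_right (0::real))"
    by (intro tendsto_norm filterlim_compose[OF der limat])
  then have "L / (2 * d) \<le> norm (deriv k c)"
  proof (rule tendsto_lowerbound)
    show "\<forall>\<^sub>F t in at_right (0::real).
        L / (2 * d) \<le> norm ((k (c + of_real t * u) - k c) / ((c + of_real t * u) - c))"
      using ev
    proof eventually_elim
      case (elim t)
      have "norm (k (c + of_real t * u) - k c) \<ge> L / (2 * d) * t"
        using low[of t] elim k1 norm_triangle_ineq2[of "k (c + of_real t * u)" "k c"] by linarith
      then show ?case using elim by (simp add: norm_divide norm_mult nu pos_le_divide_eq)
    qed
  qed simp
  moreover have "L / (2 * dist p q) \<le> L / (2 * d)"
    using dq d L by (intro divide_left_mono mult_pos_pos) auto
  ultimately show ?thesis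
    using k1 dq by (intro exI[of _ c]) (auto simp: L_def d_def)
qed

text \<open>Zalcman's rescaling: the point \<open>c\<close> maximises \<open>\<bar>k' c\<bar> * (2 * P - \<bar>c - p\<bar>)\<close> on the level set.\<close>

lemma zalcman_rescaling:
  assumes hol: "k holomorphic_on UNIV" and p: "norm (k p) > 1" and q: "norm (k q) \<le> 1"
    and P: "dist p q \<le> P"
  shows "\<exists>c. dist p c \<le> 2 * P \<and> norm (k c) = 1 \<and>
             norm (deriv k c) \<ge> ln (norm (k p)) / (4 * P) \<and>
             (\<forall>t. norm t \<le> ln (norm (k p)) / 8 \<longrightarrow>
                  norm (k (c + t / of_real (norm (deriv k c)))) \<le> exp (4 * norm t))"
proof -
  note cont = entire_continuous_on[OF hol]
  define L where "L = ln (norm (k p))"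
  have L: "L > 0" using ln_gt_zero[OF p] by (simp add: L_def)
  have "p \<noteq> q" using p q by auto
  then have P0: "P > 0" using P by (metis dual_order.strict_trans1 zero_less_dist_iff)
  obtain c1 where c1: "dist p c1 \<le> dist p q" "norm (k c1) = 1"
      "norm (deriv k c1) \<ge> L / (2 * dist p q)"
    using large_deriv_on_unit_level[OF hol p q] by (auto simp: L_def)
  have "L / (2 * P) \<le> L / (2 * dist p q)"
    using P P0 L \<open>p \<noteq> q\<close> by (intro divide_left_mono mult_pos_pos) auto
  then have c1': "norm (deriv k c1) \<ge> L / (2 * P)" using c1(3) by linarith
  define Y where "Y = cball p (2 * P) \<inter> {z. norm (k z) = 1}"
  define V where "V z = norm (deriv k z) * (2 * P - dist p z)" for z
  have "compact Y" unfolding Y_def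
    by (intro compact_Int_closed compact_cball closed_Collect_eq continuous_on_norm cont continuous_on_const)
  moreover have "c1 \<in> Y" using c1 P P0 by (simp add: Y_def)
  moreover have "continuous_on Y V"
    unfolding V_def
    by (intro continuous_intros entire_continuous_on[OF holomorphic_deriv[OF hol open_UNIV]])
  ultimately obtain c where c: "c \<in> Y" "\<And>z. z \<in> Y \<Longrightarrow> V z \<le> V c"
    using continuous_attains_sup[of Y V] by blast
  define Q where "Q = norm (deriv k c)"
  define w where "w = 2 * P - dist p c"
  \<comment> \<open>The point \<open>c1\<close> lies within \<open>P\<close> of \<open>p\<close>, so
    its weight is at least \<open>P\<close>. The resulting bound on \<open>V c\<close> also keeps
    \<open>c\<close> off the boundary, where \<open>V\<close> vanishes.\<close>
  have "V c1 \<ge> L / (2 * P) * P"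
    unfolding V_def using c1' c1(1) P P0 L by (intro mult_mono) auto
  then have Qw: "Q * w \<ge> L / 2" using c(2)[OF \<open>c1 \<in> Y\<close>] P0 by (simp add: V_def Q_def w_def)
  have w0: "w \<ge> 0" using c(1) by (simp add: Y_def w_def)
  have Qw0: "Q * w > 0" using Qw L by linarith
  then have "w \<noteq> 0" "Q \<noteq> 0" by auto
  then have w: "w > 0" and Q: "Q > 0" using w0 by (auto simp: Q_def)
  have "Q * w \<le> Q * (2 * P)" using Q by (simp add: w_def)
  then have QP: "Q \<ge> L / (4 * P)" using Qw P0 by (simp add: field_simps)
  have "norm (k (c + t / of_real Q)) \<le> exp (4 * norm t)" if t: "norm t \<le> L / 8" for t
  proof (cases "norm (k (c + t / of_real Q)) \<le> 1")
    case True
    then show ?thesis using order.trans[of _ 1 "exp (4 * norm t)"] by simp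
  next
    case False
    define z where "z = c + t / of_real Q"
    have zc: "dist z c = norm t / Q" using Q by (simp add: z_def dist_norm norm_divide)
    have kz: "norm (k z) > 1" using False by (simp add: z_def)
    have kc: "norm (k c) \<le> 1" using c(1) by (simp add: Y_def)
    \<comment> \<open>The Clunie--Hayman bound is applied once more, from \<open>z\<close> towards
      \<open>c\<close>. If \<open>norm (k z)\<close> were too large, the derivative at
      \<open>e\<close> would exceed \<open>2 * Q\<close>, but maximality of \<open>V c\<close>
      forbids this because the weight at \<open>e\<close> is at least \<open>w / 2\<close>.\<close>
    obtain e where e: "dist z e \<le> dist z c" "norm (k e) = 1"
        "norm (deriv k e) \<ge> ln (norm (k z)) / (2 * dist z c)"
      using large_deriv_on_unit_level[OF hol kz kc] by blast
    have "norm t / Q \<le> w / 4"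
      using t Qw Q by (simp add: pos_divide_le_eq) (simp add: mult.commute)
    then have "dist c e \<le> w / 2"
      using e(1) zc dist_triangle[of c e z] unfolding dist_commute[of c z] by linarith
    then have we: "2 * P - dist p e \<ge> w / 2"
      using dist_triangle[of p e c] by (simp add: w_def)
    then have "e \<in> Y" using e w by (simp add: Y_def)
    then have "V e \<le> Q * w" using c(2) by (auto simp: V_def Q_def w_def)
    moreover have "norm (deriv k e) * (w / 2) \<le> V e"
      unfolding V_def using we by (intro mult_left_mono) auto
    ultimately have "norm (deriv k e) * (w / 2) \<le> 2 * Q * (w / 2)" by simp
    then have "norm (deriv k e) \<le> 2 * Q" using w by (simp only: mult_le_cancel_right_pos half_gt_zero)
    then have le: "ln (norm (k z)) / (2 * dist z c) \<le> 2 * Q" using e(3) by linarith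
    have "z \<noteq> c" using kz kc by auto
    then have "ln (norm (k z)) \<le> 2 * Q * (2 * dist z c)"
      using le by (simp add: pos_divide_le_eq)
    also have "\<dots> = 4 * norm t" using Q by (simp add: zc)
    finally have "exp (ln (norm (k z))) \<le> exp (4 * norm t)" by (simp only: exp_le_cancel_iff)
    moreover have "norm (k z) > 0" using kz by linarith
    ultimately show ?thesis by (simp only: z_def exp_ln)
  qed
  then show ?thesis
    using c(1) QP by (intro exI[of _ c]) (auto simp: Y_def Q_def L_def)
qed

subsection \<open>Fixed points of the composition\<close>

text \<open>Because \<kappa> may be of order \<open>norm w\<close>, the small value of
  \<open>f\<close> gives only \<open>norm (k q) \<le> 4 * R\<close>, whereas Zalcman's rescaling
  needs modulus at most 1. If \<open>norm k\<close> exceeded 1 on the ball of radius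
  \<open>P\<close> about \<open>p\<close>, Harnack would give
  \<open>ln (4 * R) \<ge> ln M / 6\<close>. The exponent 16 contradicts this:
  \<open>16 / 6 > 2\<close>, while \<open>ln (4 * R) \<le> 2 * ln R\<close>.\<close>

lemma rescaling_of_oscillating_function:
  fixes f :: "complex \<Rightarrow> complex" and w z :: complex and a b \<rho> \<kappa> :: real
  defines "k \<equiv> \<lambda>s. of_real \<kappa> * (f (w * exp s) / z - 1)"
    and "P \<equiv> 2 * (ln b + 7)" and "M \<equiv> max_modulus (norm w) f"
  assumes hol: "f holomorphic_on UNIV" and b: "b > 1"
    and rho: "\<rho> \<in> {norm w<..<b * norm w}" "min_modulus \<rho> f \<le> a"
    and z: "z \<noteq> 0" "norm z \<le> norm w" "a \<le> norm z"
    and kap: "1 \<le> \<kappa>" "\<kappa> \<le> 2 * norm w"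
    and R4: "norm w \<ge> 4" and M16: "M \<ge> norm w ^ 16"
  shows "\<exists>c. norm c \<le> 2 * P + 4 \<and> norm (k c) = 1 \<and> norm (deriv k c) \<ge> ln M / (8 * P) \<and>
             (\<forall>t. norm t \<le> ln M / 16 \<longrightarrow>
                  norm (k (c + t / of_real (norm (deriv k c)))) \<le> exp (4 * norm t))"
proof -
  define R where "R = norm w"
  have R: "R \<ge> 4" "w \<noteq> 0" using R4 by (auto simp: R_def)
  have rho': "R < \<rho>" "\<rho> < b * R" using rho by (auto simp: R_def)
  have P: "P > 14" using b by (simp add: P_def)
  obtain w2 where w2: "norm w2 = R" "norm (f w2) = M"
    using max_modulus_point[OF hol, of R] R unfolding M_def R_def by auto
  obtain w1 where w1: "norm w1 = \<rho>" "norm (f w1) \<le> a"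
    using min_modulus_attained[OF entire_continuous_on[OF hol], of \<rho>] rho rho' R by auto
  define p q where "p = Ln (w2 / w)" and "q = Ln (w1 / w)"
  have "w2 \<noteq> 0" "w1 \<noteq> 0" using w1 w2 R rho' by auto
  then have ep: "w * exp p = w2" and eq: "w * exp q = w1" using R by (simp_all add: p_def q_def)
  have nz: "w2 / w \<noteq> 0" "w1 / w \<noteq> 0" using \<open>w2 \<noteq> 0\<close> \<open>w1 \<noteq> 0\<close> R by auto
  have Rep: "Re p = 0" using nz w2 by (simp add: p_def norm_divide R_def)
  have Req: "Re q = ln (\<rho> / R)" using nz w1 by (simp add: q_def norm_divide R_def)
  have Imp: "\<bar>Im p\<bar> \<le> pi" "\<bar>Im q\<bar> \<le> pi"
    using mpi_less_Im_Ln[OF nz(1)] Im_Ln_le_pi[OF nz(1)] mpi_less_Im_Ln[OF nz(2)] Im_Ln_le_pi[OF nz(2)]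
    by (auto simp: p_def q_def)
  have pi: "pi < 7/2" using pi_less_4 pi_approx by simp
  have np: "norm p \<le> 4" using cmod_le[of p] Rep Imp pi by linarith
  have "1 < \<rho> / R" "\<rho> / R < b" using rho' R by (auto simp: pos_less_divide_eq pos_divide_less_eq)
  then have "0 < Re q" "Re q < ln b" unfolding Req by (auto intro: ln_gt_zero)
  then have nq: "norm q \<le> ln b + pi" using cmod_le[of q] Imp by linarith
  \<comment> \<open>The real parts contribute at most \<open>ln b\<close> and the two arguments at
    most \<open>2 * pi < 7\<close>, whence the form of \<open>P\<close>. Staying within
    \<open>P / 2\<close> makes Harnack's factor at least 1/3.\<close>
  have dpq: "dist p q < P / 2"
    using norm_triangle_ineq4[of p q] cmod_le[of p] nq Rep Imp pi by (simp add: dist_norm P_def)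
  have M: "M > 0" using M16 R by (meson less_le_trans zero_less_norm_iff zero_less_power)
  \<comment> \<open>Dividing by \<open>z\<close> and subtracting 1 costs at most a factor
    \<open>y\<close>, so at least half of \<open>ln M\<close> survives.\<close>
  define y where "y = sqrt M"
  have y: "y > 0" "y * y = M" "ln y = ln M / 2" using M by (auto simp: y_def ln_sqrt)
  have "y \<ge> sqrt ((R ^ 8)\<^sup>2)" unfolding y_def using M16 by (simp add: R_def flip: power_mult)
  then have y8: "y \<ge> R ^ 8" using R by (simp only: real_sqrt_abs)
  have kp: "norm (k p) \<ge> y"
  proof -
    have "R * 2 \<le> R * R ^ 7" using R power_increasing[of 1 7 R] by (intro mult_left_mono) auto
    also have "\<dots> \<le> y" using y8 by (simp flip: power_Suc)
    finally have "(R * 2) * y \<le> y * y" using y by (intro mult_right_mono) auto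
    then have "2 * y \<le> M / R" using y R by (simp add: pos_le_divide_eq mult_ac)
    also have "\<dots> \<le> M / norm z" using z M by (intro divide_left_mono mult_pos_pos) (auto simp: R_def)
    also have "\<dots> = norm (f w2 / z)" by (simp add: norm_divide w2)
    finally have "2 * y - 1 \<le> norm (f w2 / z - 1)" using norm_triangle_ineq2[of "f w2 / z" 1] by simp
    moreover have "y \<ge> 1" using y8 R one_le_power[of R 8] by linarith
    ultimately have "y \<le> 1 * norm (f w2 / z - 1)" by simp
    also have "\<dots> \<le> \<kappa> * norm (f w2 / z - 1)" using kap by (intro mult_right_mono) auto
    finally show ?thesis using kap by (simp add: k_def ep norm_mult)
  qed
  define L where "L = ln (norm (k p))"
  have LM: "L \<ge> ln M / 2" using kp y unfolding L_def by (metis ln_mono)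
  have lnM: "ln M \<ge> 16 * ln R"
  proof -
    have "ln (R ^ 16) \<le> ln M" using M16 R by (intro ln_mono) (auto simp: R_def)
    then show ?thesis using R by (simp add: ln_realpow)
  qed
  have "R ^ 8 > 1" using R by (intro one_less_power) auto
  then have kp1: "norm (k p) > 1" using kp y8 by linarith
  have kq: "norm (k q) \<le> 4 * R"
  proof -
    have "norm (f w1 / z - 1) \<le> norm (f w1) / norm z + 1"
      using norm_triangle_ineq4[of "f w1 / z" 1] by (simp add: norm_divide)
    also have "\<dots> \<le> 2" using w1 z by simp
    finally have "\<kappa> * norm (f w1 / z - 1) \<le> (2 * R) * 2" using kap by (intro mult_mono) (auto simp: R_def)
    then show ?thesis using kap by (simp add: k_def eq norm_mult)
  qed
  have holk: "k holomorphic_on UNIV" unfolding k_def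
    by (intro holomorphic_intros holomorphic_on_compose_gen[OF _ hol, unfolded o_def]) (use z in auto)
  have "\<exists>q'. dist p q' \<le> P \<and> norm (k q') \<le> 1"
  proof (rule ccontr)
    assume "\<not> ?thesis"
    then have gt: "norm (k x) > 1" if "x \<in> ball p P" for x using that by (metis mem_ball not_le less_imp_le)
    have qb: "q \<in> ball p P" using dpq P by simp
    have "ln (norm (k q)) \<ge> L * (P - dist p q) / (P + dist p q)"
      unfolding L_def using P by (intro harnack_ln_norm gt qb holomorphic_on_subset[OF holk]) auto
    moreover have "L / 3 \<le> L * (P - dist p q) / (P + dist p q)"
    proof -
      have "L * (P + dist p q) \<le> L * (3 * (P - dist p q))"
        using dpq kp1 by (intro mult_left_mono) (auto simp: L_def ln_ge_zero)
      moreover have "P + dist p q > 0" using P by (simp add: add_pos_nonneg)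
      ultimately show ?thesis by (simp add: pos_le_divide_eq algebra_simps)
    qed
    moreover have "ln (norm (k q)) \<le> ln (4 * R)"
      using kq gt[OF qb] by (intro ln_mono) linarith+
    moreover have "ln (4 * R) = ln 4 + ln R" using R by (simp add: ln_mult)
    moreover have "ln 4 \<le> ln R" using R by simp
    moreover have "ln (4::real) > 0" by simp
    ultimately show False using LM lnM by argo
  qed
  then obtain q' where q': "dist p q' \<le> P" "norm (k q') \<le> 1" by blast
  obtain c where c: "dist p c \<le> 2 * P" "norm (k c) = 1" "norm (deriv k c) \<ge> L / (4 * P)"
    "\<And>t. norm t \<le> L / 8 \<Longrightarrow> norm (k (c + t / of_real (norm (deriv k c)))) \<le> exp (4 * norm t)"
    using zalcman_rescaling[OF holk kp1 q'(2,1)] by (auto simp: L_def)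
  have "norm c \<le> norm p + dist p c" using norm_triangle_ineq4[of p "p - c"] by (simp add: dist_norm)
  then have "norm c \<le> 2 * P + 4" using c(1) np by linarith
  moreover have "ln M / (8 * P) \<le> L / (4 * P)"
    using divide_right_mono[OF LM, of "4 * P"] P by simp
  ultimately show ?thesis using c LM by (intro exI[of _ c]) auto
qed

text \<open>\<open>f\<close> sees only \<open>s\<close>, while \<theta> sees the shifted
  \<open>S\<close>; the two differ by a period of exp. Differentiating \<open>k\<close> expresses
  \<open>deriv f\<close>, and differentiating the exponential law gives
  \<open>deriv g \<xi> * \<xi> * deriv \<theta> S / \<nu> = g \<xi>\<close>. In the product \<nu>
  cancels and \<open>m / 24\<close> times the derivative of \<open>k\<close> remains, where 24 is 4
  times the bounds 3 for \<open>norm \<xi> / norm z\<close> and 2 for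
  \<open>deriv \<theta>\<close>.\<close>

lemma fixed_point_estimates:
  fixes f g \<theta> :: "complex \<Rightarrow> complex" and z S s :: complex and m \<nu> K C :: real
  defines "k \<equiv> \<lambda>s. of_real (4 * \<nu> / m) * (f (g z * exp s) / z - 1)"
    and "\<xi> \<equiv> z * exp (\<theta> S / of_real \<nu>)"
  assumes f: "f holomorphic_on UNIV" and g: "g holomorphic_on UNIV"
    and m: "m \<ge> 4" and nu: "m\<^sup>2 \<le> \<nu>" and z: "z \<noteq> 0" "g z \<noteq> 0"
    and th: "\<theta> holomorphic_on ball 0 m"
      "\<forall>S\<in>ball 0 m. norm (\<theta> S - S) \<le> 1 / m \<and> g (z * exp (\<theta> S / of_real \<nu>)) = g z * exp S"
    and mx: "\<forall>\<sigma>. \<bar>\<sigma>\<bar> \<le> m + 1 \<longrightarrow>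
              max_modulus (norm z * exp (\<sigma> / \<nu>)) g \<le> norm (g z) * exp (\<sigma> + 1 / m)"
    and S: "norm S < m - 1" "exp S = exp s" "Re S \<le> C"
    and ks: "k s = of_real (4 * \<nu> / m) * (exp (\<theta> S / of_real \<nu>) - 1)"
    and K: "norm (deriv k s) \<ge> K" "K \<ge> 0"
  shows "f (g \<xi>) = \<xi>" "norm \<xi> \<ge> norm z / 3" "norm (deriv (f \<circ> g) \<xi>) \<ge> K / 6"
    "norm (g \<xi>) \<ge> (1 - 2 / m) * max_modulus (norm \<xi>) g"
    "max_modulus (norm \<xi>) g \<le> norm (g z) * exp (C + 1)"
proof -
  have nu0: "\<nu> > 0" using nu m by (smt (verit) zero_less_power)
  have Sb: "S \<in> ball 0 m" using S by simp
  have gx: "g \<xi> = g z * exp S" using bspec[OF th(2) Sb] by (simp add: \<xi>_def)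
  have thS: "norm (\<theta> S - S) \<le> 1 / m" using bspec[OF th(2) Sb] by simp
  have m1: "1 / m \<le> 1/4" using m by simp
  have "k s = of_real (4 * \<nu> / m) * (f (g \<xi>) / z - 1)" by (simp add: k_def gx S(2))
  then have "f (g \<xi>) / z = exp (\<theta> S / of_real \<nu>)" using ks nu0 m by simp
  then show "f (g \<xi>) = \<xi>" using z by (simp add: \<xi>_def field_simps)
  have nth: "norm (\<theta> S) \<le> m" using norm_triangle_ineq[of S "\<theta> S - S"] thS m1 S(1) by simp
  have "m * 1 \<le> m * m" using m by (intro mult_left_mono) auto
  then have "m \<le> \<nu>" using nu by (simp add: power2_eq_square)
  then have thn: "norm (\<theta> S / of_real \<nu>) \<le> 1" using nth nu0 by (simp add: norm_divide)
  have Re1: "\<bar>Re (\<theta> S) / \<nu>\<bar> \<le> 1"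
    using abs_Re_le_cmod[of "\<theta> S / of_real \<nu>"] thn by simp
  have nxi: "norm \<xi> = norm z * exp (Re (\<theta> S) / \<nu>)" by (simp add: \<xi>_def norm_mult)
  have "exp (Re (\<theta> S) / \<nu>) \<le> exp 1" using Re1 by (simp only: exp_le_cancel_iff)
  then have up3: "exp (Re (\<theta> S) / \<nu>) \<le> 3" using exp_le by linarith
  have "exp (- 1) \<le> exp (Re (\<theta> S) / \<nu>)" using Re1 by (simp only: exp_le_cancel_iff)
  moreover have "1/3 \<le> exp (-1::real)" using exp_le by (simp add: exp_minus field_simps)
  ultimately have low3: "exp (Re (\<theta> S) / \<nu>) \<ge> 1/3" by linarith
  show "norm \<xi> \<ge> norm z / 3" using mult_left_mono[OF low3, of "norm z"] by (simp add: nxi)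
  have xi3: "norm \<xi> \<le> 3 * norm z" using mult_left_mono[OF up3, of "norm z"] by (simp add: nxi)
  have xi0: "\<xi> \<noteq> 0" using z by (simp add: \<xi>_def)
  have gx0: "g \<xi> \<noteq> 0" using z by (simp add: gx)
  have df: "(f has_field_derivative deriv f x) (at x)" for x
    using holomorphic_derivI[OF f open_UNIV] by simp
  have dg: "(g has_field_derivative deriv g x) (at x)" for x
    using holomorphic_derivI[OF g open_UNIV] by simp
  have dth: "(\<theta> has_field_derivative deriv \<theta> S) (at S)"
    using holomorphic_derivI[OF th(1) open_ball Sb] .
  have "deriv k s = of_real (4 * \<nu> / m) * (deriv f (g \<xi>) * g \<xi> / z)"
  proof (rule DERIV_imp_deriv)
    have "(k has_field_derivative of_real (4 * \<nu> / m) * (deriv f (g z * exp s) * (g z * exp s) / z)) (at s)"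
      unfolding k_def by (rule derivative_eq_intros DERIV_chain2[OF df] refl z | simp add: z mult_ac)+
    then show "(k has_field_derivative of_real (4 * \<nu> / m) * (deriv f (g \<xi>) * g \<xi> / z)) (at s)"
      by (simp add: gx S(2))
  qed
  then have "norm (deriv k s) = 4 * \<nu> / m * (norm (deriv f (g \<xi>)) * norm (g \<xi>) / norm z)"
    using nu0 m by (simp add: norm_mult norm_divide)
  then have A: "norm (deriv f (g \<xi>)) * norm (g \<xi>) = norm (deriv k s) * m * norm z / (4 * \<nu>)"
    using nu0 m z by (simp add: field_simps)
  have "((\<lambda>x. g (z * exp (\<theta> x / of_real \<nu>))) has_field_derivative
          deriv g \<xi> * (\<xi> * (deriv \<theta> S / of_real \<nu>))) (at S)"
    unfolding \<xi>_def by (rule derivative_eq_intros DERIV_chain2[OF dg] dth refl | use nu0 in simp)+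
  moreover have "((\<lambda>x. g (z * exp (\<theta> x / of_real \<nu>))) has_field_derivative g z * exp S) (at S)"
  proof (rule has_field_derivative_transform_within_open[of "\<lambda>x. g z * exp x" _ _ "ball 0 m"])
    show "((\<lambda>x. g z * exp x) has_field_derivative g z * exp S) (at S)"
      by (rule derivative_eq_intros refl | simp)+
  qed (use Sb th(2) in auto)
  ultimately have "deriv g \<xi> * (\<xi> * (deriv \<theta> S / of_real \<nu>)) = g \<xi>"
    using DERIV_unique gx by metis
  then have "norm (deriv g \<xi>) * (norm \<xi> * (norm (deriv \<theta> S) / \<nu>)) = norm (g \<xi>)"
    using nu0 by (metis norm_mult norm_divide norm_of_real abs_of_pos)
  moreover have "norm (deriv \<theta> S) \<le> 2"
  proof -
    have cb: "cball S 1 \<subseteq> ball 0 m"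
    proof
      fix x assume "x \<in> cball S 1"
      then show "x \<in> ball 0 m"
        using S(1) norm_triangle_ineq2[of x S] by (simp add: dist_norm norm_minus_commute)
    qed
    have hol: "(\<lambda>x. \<theta> x - x) holomorphic_on ball 0 m" by (intro holomorphic_intros th)
    have "norm (\<theta> x - x) \<le> 1" if "x \<in> ball 0 m" for x
      using bspec[OF th(2) that] m1 by linarith
    then have "norm (deriv (\<lambda>x. \<theta> x - x) S) \<le> 1" by (rule norm_deriv_le_of_bound[OF hol cb])
    moreover have "deriv (\<lambda>x. \<theta> x - x) S = deriv \<theta> S - 1"
      by (rule DERIV_imp_deriv derivative_eq_intros dth refl)+
    ultimately have "norm (deriv \<theta> S - 1) \<le> 1" by simp
    then show ?thesis using norm_triangle_ineq2[of "deriv \<theta> S" 1] by simp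
  qed
  then have "norm (deriv g \<xi>) * (norm \<xi> * (norm (deriv \<theta> S) / \<nu>)) \<le>
             norm (deriv g \<xi>) * (3 * norm z * (2 / \<nu>))"
    using xi3 nu0 by (intro mult_left_mono mult_mono divide_right_mono) auto
  ultimately have Bd: "norm (g \<xi>) * \<nu> \<le> norm (deriv g \<xi>) * (6 * norm z)"
    using nu0 by (simp add: field_simps)
  have "deriv (f \<circ> g) \<xi> = deriv f (g \<xi>) * deriv g \<xi>"
    by (intro DERIV_imp_deriv DERIV_chain df dg)
  then have "norm (deriv (f \<circ> g) \<xi>) * (6 * norm z) = norm (deriv f (g \<xi>)) * (norm (deriv g \<xi>) * (6 * norm z))"
    by (simp add: norm_mult)
  also have "\<dots> \<ge> norm (deriv f (g \<xi>)) * (norm (g \<xi>) * \<nu>)"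
    using Bd by (intro mult_left_mono) auto
  also have "norm (deriv f (g \<xi>)) * (norm (g \<xi>) * \<nu>) = norm (deriv k s) * m / 4 * norm z"
    using A nu0 by (simp add: field_simps)
  finally have "norm (deriv k s) * m / 4 * norm z \<le> (6 * norm (deriv (f \<circ> g) \<xi>)) * norm z"
    by (simp add: mult_ac o_def)
  then have "norm (deriv k s) * m / 4 \<le> 6 * norm (deriv (f \<circ> g) \<xi>)" using z by simp
  moreover have "K * 1 \<le> norm (deriv k s) * (m / 4)" using K m by (intro mult_mono) auto
  ultimately show "norm (deriv (f \<circ> g) \<xi>) \<ge> K / 6" by simp
  \<comment> \<open>Two errors of size \<open>1 / m\<close>, from replacing \<open>S\<close> by
    \<open>\<theta> S\<close> and from the bound \<open>mx\<close>, add up to the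
    \<open>2 / m\<close> of the conclusion.\<close>
  define \<sigma> where "\<sigma> = Re (\<theta> S)"
  have "\<bar>\<sigma>\<bar> \<le> m + 1" using abs_Re_le_cmod[of "\<theta> S"] nth by (simp add: \<sigma>_def)
  then have mxx: "max_modulus (norm \<xi>) g \<le> norm (g z) * exp (\<sigma> + 1 / m)"
    using mx by (simp add: nxi \<sigma>_def)
  have sS: "\<bar>\<sigma> - Re S\<bar> \<le> 1 / m" using abs_Re_le_cmod[of "\<theta> S - S"] thS by (simp add: \<sigma>_def)
  have ngx: "norm (g \<xi>) = norm (g z) * exp (Re S)" by (simp add: gx norm_mult)
  have "norm (g z) * exp (\<sigma> + 1 / m) \<le> norm (g z) * exp (Re S + 2 / m)"
    using sS by (intro mult_left_mono) (auto simp: abs_le_iff field_simps)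
  then have mx2: "max_modulus (norm \<xi>) g \<le> norm (g z) * exp (Re S + 2 / m)" using mxx by linarith
  have "2 / m = 2 * (1 / m)" by simp
  then have "Re S + 2 / m \<le> C + 1" using m1 S(3) by linarith
  then have "norm (g z) * exp (Re S + 2 / m) \<le> norm (g z) * exp (C + 1)" by (intro mult_left_mono) auto
  then show "max_modulus (norm \<xi>) g \<le> norm (g z) * exp (C + 1)" using mx2 by linarith
  have M0: "max_modulus (norm \<xi>) g \<ge> 0"
    using norm_le_max_modulus[OF g, of \<xi>] norm_ge_zero order.trans by blast
  have "(1 - 2 / m) * max_modulus (norm \<xi>) g \<le> exp (- (2 / m)) * max_modulus (norm \<xi>) g"
    using exp_ge_add_one_self[of "- (2 / m)"] M0 by (intro mult_right_mono) auto
  also have "\<dots> \<le> exp (- (2 / m)) * (norm (g z) * exp (Re S + 2 / m))"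
    using mx2 by (intro mult_left_mono) auto
  also have "\<dots> = norm (g \<xi>)" by (simp add: ngx exp_add exp_minus)
  finally show "norm (g \<xi>) \<ge> (1 - 2 / m) * max_modulus (norm \<xi>) g" .
qed

text \<open>A whole segment of values is offered because single ones may fail: Picard's theorem
  excludes at most one, and the critical values are countable since \<open>deriv F\<close> is not
  identically zero. An interval is uncountable.\<close>

lemma noncritical_imaginary_value:
  assumes hol: "F holomorphic_on UNIV" and nz: "deriv F 0 \<noteq> 0"
  shows "\<exists>b t. 0 < b \<and> b < 1 \<and> F t = \<i> * of_real b \<and> deriv F t \<noteq> 0"
proof (rule ccontr)
  assume neg: "\<not> ?thesis"
  note holD = holomorphic_deriv[OF hol open_UNIV]
  have "countable {t \<in> UNIV. deriv F t = 0}"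
  proof (cases "deriv F constant_on UNIV")
    case True
    then have "{t \<in> UNIV. deriv F t = 0} = {}" using nz by (auto simp: constant_on_def)
    then show ?thesis by simp
  next
    case False
    then show ?thesis by (intro holomorphic_countable_zeros[OF holD]) auto
  qed
  then have crit: "countable ((\<lambda>t. Im (F t)) ` {t \<in> UNIV. deriv F t = 0})" by (rule countable_image)
  define E where "E = {b. \<i> * of_real b \<notin> range F}"
  have "finite E"
  proof (cases "\<exists>x y. x \<in> E \<and> y \<in> E \<and> x \<noteq> y")
    case True
    then obtain x y where "x \<in> E" "y \<in> E" "x \<noteq> y" by blast
    then obtain C where "F = (\<lambda>x. C)"
      using little_Picard[OF hol, of "\<i> * of_real x" "\<i> * of_real y"] by (auto simp: E_def)
    then show ?thesis using nz by simp
  next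
    case False
    then have "E \<subseteq> {SOME x. x \<in> E}" by (metis insertI1 someI subsetI)
    then show ?thesis using finite_subset by blast
  qed
  moreover have "{0<..<1::real} \<subseteq> E \<union> (\<lambda>t. Im (F t)) ` {t \<in> UNIV. deriv F t = 0}"
  proof
    fix b :: real assume b: "b \<in> {0<..<1}"
    show "b \<in> E \<union> (\<lambda>t. Im (F t)) ` {t \<in> UNIV. deriv F t = 0}"
    proof (cases "b \<in> E")
      case False
      then obtain t where t: "F t = \<i> * of_real b" by (auto simp: E_def)
      then have "deriv F t = 0" using neg b by auto
      then show ?thesis using t by (auto intro!: image_eqI[of _ _ t])
    qed auto
  qed
  ultimately have "countable {0<..<1::real}"
    using crit by (meson countable_Un countable_finite countable_subset)
  then show False using uncountable_open_interval[of 0 1] by simp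
qed

text \<open>With \<open>u = T / \<nu>\<close>, the linear part of \<open>exp u - 1\<close>
  contributes \<open>4 * T / m\<close>, which is \<open>\<i> * b\<close> up to
  \<open>4 * (D + 1) / m\<close>; the quadratic remainder contributes at most \<open>12 / m\<close>
  because \<open>\<nu> \<ge> m\<^sup>2\<close>.\<close>

lemma target_approximation:
  fixes m \<nu> D b :: real and S T :: complex
  assumes m: "m \<ge> 4" "m \<ge> 2 * (D + 1)" and nu: "m\<^sup>2 \<le> \<nu>" and b: "0 < b" "b < 1"
    and S: "norm (S - \<i> * of_real (b * m / 4)) \<le> D" and T: "norm (T - S) \<le> 1 / m"
  shows "norm (of_real (4 * \<nu> / m) * (exp (T / of_real \<nu>) - 1) - \<i> * of_real b) \<le> (40 + 4 * D) / m"
proof -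
  have D: "D \<ge> 0" using S norm_ge_zero order.trans by blast
  have m1: "1 / m \<le> 1" using m by simp
  have mm: "m * 4 \<le> m * m" using m by (intro mult_left_mono) auto
  then have nu0: "\<nu> > 0" "m \<le> \<nu>" using nu m(1) mm unfolding power2_eq_square by linarith+
  have Tb: "norm (T - \<i> * of_real (b * m / 4)) \<le> D + 1"
    using norm_triangle_ineq[of "T - S" "S - \<i> * of_real (b * m / 4)"] S T m1 by simp
  have "norm (\<i> * complex_of_real (b * m / 4)) = b * m / 4" using b m by (simp add: norm_mult)
  also have "\<dots> \<le> m / 4" using b m by simp
  finally have "norm (\<i> * complex_of_real (b * m / 4)) \<le> m / 4" .
  then have nT: "norm T \<le> m"
    using norm_triangle_ineq[of "T - \<i> * of_real (b * m / 4)" "\<i> * of_real (b * m / 4)"] Tb m by simp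
  define u where "u = T / of_real \<nu>"
  have nu1: "norm u \<le> m / \<nu>" using nT nu0 by (simp add: u_def norm_divide divide_right_mono)
  also have "\<dots> \<le> 1" using nu0 by simp
  finally have u1: "norm u \<le> 1" .
  have "norm (exp u - (\<Sum>k\<le>1. u ^ k / fact k)) \<le> exp \<bar>Re u\<bar> * norm u ^ Suc 1 / fact 1"
    by (rule Taylor_exp)
  moreover have "exp \<bar>Re u\<bar> \<le> 3"
  proof -
    have "exp \<bar>Re u\<bar> \<le> exp 1" using abs_Re_le_cmod[of u] u1 by (simp only: exp_le_cancel_iff)
    then show ?thesis using exp_le by linarith
  qed
  then have "exp \<bar>Re u\<bar> * norm u ^ Suc 1 / fact 1 \<le> 3 * (m / \<nu>) ^ 2"
    using mult_mono[OF _ power_mono[OF nu1, of 2], of "exp \<bar>Re u\<bar>" 3] by (simp add: numeral_2_eq_2)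
  ultimately have e: "norm (exp u - 1 - u) \<le> 3 * (m / \<nu>) ^ 2" by (simp add: diff_diff_eq)
  have "norm (of_real (4 * \<nu> / m) * (exp u - 1 - u)) \<le> 4 * \<nu> / m * (3 * (m / \<nu>) ^ 2)"
    unfolding norm_mult using e nu0 m by (intro mult_mono) (auto simp: norm_mult norm_divide)
  also have "\<dots> = 12 * (m / \<nu>)" using nu0 m by (simp add: power2_eq_square)
  also have "m / \<nu> \<le> m / m\<^sup>2" using nu m nu0 by (intro divide_left_mono mult_pos_pos) auto
  also have "m / m\<^sup>2 = 1 / m" using m by (simp add: power2_eq_square)
  finally have 1: "norm (of_real (4 * \<nu> / m) * (exp u - 1 - u)) \<le> 12 / m" by simp
  have "norm (of_real (4 / m) * (T - \<i> * of_real (b * m / 4))) \<le> 4 / m * (D + 1)"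
    unfolding norm_mult using Tb m by (intro mult_mono) (auto simp: norm_divide)
  moreover have "of_real (4 * \<nu> / m) * (exp u - 1) - \<i> * of_real b =
      of_real (4 * \<nu> / m) * (exp u - 1 - u) + of_real (4 / m) * (T - \<i> * of_real (b * m / 4))"
    using nu0 m by (simp add: u_def field_simps)
  ultimately have "norm (of_real (4 * \<nu> / m) * (exp u - 1) - \<i> * of_real b) \<le> 12 / m + 4 / m * (D + 1)"
    using 1 norm_triangle_mono by metis
  also have "\<dots> = (16 + 4 * D) / m" by (simp add: add_divide_distrib algebra_simps)
  also have "\<dots> \<le> (40 + 4 * D) / m" using m by (intro divide_right_mono) auto
  finally show ?thesis by (simp add: u_def)
qed

text \<open>Hurwitz' theorem for the differences: their limit \<open>F - v\<close> vanishes at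
  \<open>t0\<close> and is nonconstant because its derivative there is nonzero. The target
  \<open>A n\<close> may depend on \<open>t\<close>.\<close>

lemma frequently_zero_near_limit_zero:
  fixes \<phi> A :: "nat \<Rightarrow> complex \<Rightarrow> complex"
  assumes \<epsilon>: "\<epsilon> > 0"
    and hol\<phi>: "\<And>n. \<phi> n holomorphic_on ball t0 \<epsilon>"
    and holA: "\<forall>\<^sub>F n in sequentially. A n holomorphic_on ball t0 \<epsilon>"
    and F: "F holomorphic_on ball t0 \<epsilon>" "F t0 = v" "deriv F t0 \<noteq> 0"
    and lim\<phi>: "uniform_limit (ball t0 \<epsilon>) \<phi> F sequentially"
    and limA: "uniform_limit (ball t0 \<epsilon>) A (\<lambda>_. v) sequentially"
  shows "\<exists>n\<ge>n0. \<exists>t\<in>ball t0 \<epsilon>. \<phi> n t = A n t"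
proof (rule ccontr)
  assume neg: "\<not> ?thesis"
  obtain n1 where n1: "\<And>n. n \<ge> n1 \<Longrightarrow> A n holomorphic_on ball t0 \<epsilon>"
    using holA by (auto simp: eventually_sequentially)
  \<comment> \<open>Hurwitz' theorem is applied to a sequence holomorphic for every index, so the
    tail from \<open>N\<close> on is used; the shift also enforces
    \<open>n \<ge> n0\<close>.\<close>
  define N where "N = max n0 n1"
  have dF: "(F has_field_derivative deriv F t0) (at t0)"
    using holomorphic_derivI[OF F(1) open_ball] \<epsilon> by simp
  have "F t0 - v \<noteq> 0"
  proof (rule Hurwitz_no_zeros[of "ball t0 \<epsilon>" "\<lambda>n t. \<phi> (n + N) t - A (n + N) t"
        "\<lambda>t. F t - v" t0])
    show "(\<lambda>t. \<phi> (n + N) t - A (n + N) t) holomorphic_on ball t0 \<epsilon>" for n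
      by (intro holomorphic_intros hol\<phi> n1) (simp add: N_def)
    show "(\<lambda>t. F t - v) holomorphic_on ball t0 \<epsilon>" by (intro holomorphic_intros F)
    have "uniform_limit (ball t0 \<epsilon>) (\<lambda>n t. \<phi> n t - A n t) (\<lambda>t. F t - v) sequentially"
      by (intro uniform_limit_intros lim\<phi> limA)
    then have "uniform_limit (ball t0 \<epsilon>) (\<lambda>n t. \<phi> (n + N) t - A (n + N) t) (\<lambda>t. F t - v) sequentially"
      using filterlim_compose[OF _ filterlim_add_const_nat_at_top[of N]] by fastforce
    then show "uniform_limit K (\<lambda>n t. \<phi> (n + N) t - A (n + N) t) (\<lambda>t. F t - v) sequentially"
      if "compact K" "K \<subseteq> ball t0 \<epsilon>" for K using that uniform_limit_on_subset by blast
    have "deriv (\<lambda>t. F t - v) t0 = deriv F t0"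
      by (rule DERIV_imp_deriv derivative_eq_intros dF refl | simp)+
    then show "\<not> (\<lambda>t. F t - v) constant_on ball t0 \<epsilon>"
      using F \<epsilon> by (intro holomorphic_nonconstant[where \<xi> = t0] holomorphic_intros) auto
    show "\<phi> (n + N) t - A (n + N) t \<noteq> 0" if "t \<in> ball t0 \<epsilon>" for n t
      using neg that by (auto simp: N_def)
  qed (use \<epsilon> in auto)
  then show False using F by simp
qed

theorem theorem1p2:
  fixes f g :: "complex \<Rightarrow> complex"
  assumes "transcendental_entire f" and "transcendental_entire g"
    and "\<exists>a b r0 :: real. a > 0 \<and> b > 1 \<and> r0 > 0 \<and>
           (\<forall>r\<ge>r0. \<exists>\<rho>\<in>{r<..<b * r}. min_modulus \<rho> f \<le> a)"
  shows "\<exists>(\<alpha> :: real) (\<beta> :: real) (\<xi> :: nat \<Rightarrow> complex) (\<delta> :: nat \<Rightarrow> real).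
           \<alpha> > 0 \<and> \<beta> > 0 \<and>
           (\<forall>k. (f \<circ> g) (\<xi> k) = \<xi> k) \<and>
           filterlim (\<lambda>k. norm (\<xi> k)) at_top sequentially \<and>
           \<delta> \<longlonglongrightarrow> 0 \<and>
           (\<forall>k. norm (deriv (f \<circ> g) (\<xi> k))
                   \<ge> \<alpha> * ln (max_modulus (\<beta> * max_modulus (norm (\<xi> k)) g) f)) \<and>
           (\<forall>k. norm (g (\<xi> k)) \<ge> (1 - \<delta> k) * max_modulus (norm (\<xi> k)) g)"
proof -

  \<comment> \<open>Maximum points of \<open>g\<close> and the exponential law around them\<close>
  note holf = transcendental_holomorphic[OF assms(1)]
  note holg = transcendental_holomorphic[OF assms(2)]
  obtain a b r0 :: real where ab: "a > 0" "b > 1" "r0 > 0"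
    and small: "\<And>r. r \<ge> r0 \<Longrightarrow> \<exists>\<rho>\<in>{r<..<b * r}. min_modulus \<rho> f \<le> a"
    using assms(3) by blast
  obtain R1 where R1: "\<And>r. r \<ge> R1 \<Longrightarrow> max_modulus r f \<ge> r ^ 16"
    using transcendental_max_modulus_ge_power[OF assms(1)] by blast
  define m where "m n = real n + 4" for n
  have m4: "m n \<ge> 4" for n by (simp add: m_def)
  obtain z :: "nat \<Rightarrow> complex" and \<nu> :: "nat \<Rightarrow> real" and \<theta> :: "nat \<Rightarrow> complex \<Rightarrow> complex" where
    z: "\<And>n. norm (z n) \<ge> Max {a, r0, R1, m n}" "\<And>n. z n \<noteq> 0" "\<And>n. norm (z n) \<le> norm (g (z n))"
    and nu: "\<And>n. (m n)\<^sup>2 \<le> \<nu> n" "\<And>n. \<nu> n \<le> 2 * norm (g (z n))"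
    and hol\<theta>: "\<And>n. \<theta> n holomorphic_on ball 0 (m n)"
    and \<theta>: "\<And>n S. S \<in> ball 0 (m n) \<Longrightarrow> norm (\<theta> n S - S) \<le> 1 / m n \<and>
              g (z n * exp (\<theta> n S / of_real (\<nu> n))) = g (z n) * exp S"
    and mx: "\<And>n \<sigma>. \<bar>\<sigma>\<bar> \<le> m n + 1 \<Longrightarrow>
              max_modulus (norm (z n) * exp (\<sigma> / \<nu> n)) g \<le> norm (g (z n)) * exp (\<sigma> + 1 / m n)"
  proof -
    have "\<exists>z \<nu> \<theta>. norm z \<ge> Max {a, r0, R1, m n} \<and> z \<noteq> 0 \<and> norm z \<le> norm (g z) \<and>
           (m n)\<^sup>2 \<le> \<nu> \<and> \<nu> \<le> 2 * norm (g z) \<and> \<theta> holomorphic_on ball 0 (m n) \<and>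
           (\<forall>S\<in>ball 0 (m n). norm (\<theta> S - S) \<le> 1 / m n \<and> g (z * exp (\<theta> S / of_real \<nu>)) = g z * exp S) \<and>
           (\<forall>\<sigma>. \<bar>\<sigma>\<bar> \<le> m n + 1 \<longrightarrow>
              max_modulus (norm z * exp (\<sigma> / \<nu>)) g \<le> norm (g z) * exp (\<sigma> + 1 / m n))" for n
      using m4[of n] by (intro exponential_behaviour_near_maximum[OF assms(2)]) auto
    then show thesis using that by metis
  qed
  define w where "w n = g (z n)" for n
  define M where "M n = max_modulus (norm (w n)) f" for n
  define P where "P = 2 * (ln b + 7)"
  have P: "P > 14" using ab by (simp add: P_def)
  have zw: "norm (z n) \<le> norm (w n)" for n using z(3) by (simp add: w_def)
  have zn: "a \<le> norm (z n)" "r0 \<le> norm (w n)" "R1 \<le> norm (w n)" "m n \<le> norm (z n)"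
      "m n \<le> norm (w n)" for n
    using z(1)[of n] zw[of n] by auto
  have w0: "w n \<noteq> 0" for n using zn(5)[of n] m4[of n] by auto
  have nu_pos: "\<nu> n > 0" for n using nu(1)[of n] m4[of n] by (smt (verit) zero_less_power)
  have M16: "M n \<ge> norm (w n) ^ 16" for n using R1 zn(3) by (simp add: M_def)
  have Mn: "M n \<ge> m n" for n
  proof -
    have "norm (w n) ^ 1 \<le> norm (w n) ^ 16"
      using zn(5)[of n] m4[of n] by (intro power_increasing) auto
    then show ?thesis using M16[of n] zn(5)[of n] by simp
  qed
  have lnM: "filterlim (\<lambda>n. ln (M n)) at_top sequentially"
  proof (rule filterlim_at_top_mono)
    show "filterlim (\<lambda>n. ln (real n)) at_top sequentially"
      by (rule filterlim_compose[OF ln_at_top filterlim_real_sequentially])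
    show "\<forall>\<^sub>F n in sequentially. ln (real n) \<le> ln (M n)"
      using eventually_gt_at_top[of 0]
    proof eventually_elim
      case (elim n)
      then show ?case using Mn[of n] by (intro ln_mono) (auto simp: m_def)
    qed
  qed

  \<comment> \<open>Normalisation of \<open>f\<close>\<close>
  define k where "k n = (\<lambda>s. of_real (4 * \<nu> n / m n) * (f (w n * exp s) / z n - 1))" for n
  have "\<exists>c. norm c \<le> 2 * P + 4 \<and> norm (k n c) = 1 \<and> norm (deriv (k n) c) \<ge> ln (M n) / (8 * P) \<and>
             (\<forall>t. norm t \<le> ln (M n) / 16 \<longrightarrow>
                norm (k n (c + t / of_real (norm (deriv (k n) c)))) \<le> exp (4 * norm t))" for n
  proof -
    obtain \<rho> where \<rho>: "\<rho> \<in> {norm (w n)<..<b * norm (w n)}" "min_modulus \<rho> f \<le> a"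
      using small[OF zn(2)] by blast
    \<comment> \<open>The normalising factor is at least 1 because
      \<open>\<nu> \<ge> m\<^sup>2\<close>, and at most \<nu>, hence at most
      \<open>2 * norm (w n)\<close>, because \<open>m \<ge> 4\<close>.\<close>
    have "m n * 1 \<le> m n * m n" using m4[of n] by (intro mult_left_mono) auto
    then have "m n \<le> 4 * \<nu> n" using nu(1)[of n] nu_pos[of n] by (simp add: power2_eq_square)
    then have kap: "1 \<le> 4 * \<nu> n / m n" using m4[of n] by simp
    have "4 * \<nu> n \<le> m n * \<nu> n" using m4[of n] nu_pos[of n] by (intro mult_right_mono) auto
    then have "4 * \<nu> n / m n \<le> \<nu> n" using m4[of n] by (simp add: pos_divide_le_eq mult.commute)
    then have "4 * \<nu> n / m n \<le> 2 * norm (w n)" using nu(2)[of n] by (simp add: w_def)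
    moreover have "norm (w n) \<ge> 4" using zn(5)[of n] m4[of n] by linarith
    ultimately show ?thesis
      using rescaling_of_oscillating_function[OF holf ab(2) \<rho> z(2) zw zn(1) kap _ _ M16[unfolded M_def]]
      unfolding k_def P_def M_def by blast
  qed
  then obtain c where c: "\<And>n. norm (c n) \<le> 2 * P + 4" "\<And>n. norm (k n (c n)) = 1"
      "\<And>n. norm (deriv (k n) (c n)) \<ge> ln (M n) / (8 * P)"
    and growth: "\<And>n t. norm t \<le> ln (M n) / 16 \<Longrightarrow>
       norm (k n (c n + t / of_real (norm (deriv (k n) (c n))))) \<le> exp (4 * norm t)"
    by metis
  define Q where "Q n = norm (deriv (k n) (c n))" for n
  have lnM_pos: "ln (M n) > 0" for n using Mn[of n] m4[of n] by (intro ln_gt_zero) linarith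
  have QM: "Q n \<ge> ln (M n) / (8 * P)" for n using c(3) by (simp add: Q_def)
  have Q0: "Q n > 0" for n
  proof -
    have "ln (M n) / (8 * P) > 0" using lnM_pos P by simp
    then show ?thesis using QM[of n] by linarith
  qed
  have holk: "k n holomorphic_on UNIV" for n unfolding k_def
    by (intro holomorphic_intros holomorphic_on_compose_gen[OF _ holf, unfolded o_def]) (use z in auto)
  have derk: "(k n has_field_derivative deriv (k n) x) (at x)" for n x
    using holomorphic_derivI[OF holk open_UNIV] by simp

  \<comment> \<open>The rescaled functions and their limit\<close>
  define \<phi> where "\<phi> n t = k n (c n + t / of_real (Q n))" for n t
  have hol\<phi>: "\<phi> n holomorphic_on UNIV" for n unfolding \<phi>_def
    by (intro holomorphic_intros holomorphic_on_compose_gen[OF _ holk, unfolded o_def])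
       (use Q0[of n] in auto)
  have der\<phi>: "deriv (\<phi> n) t = deriv (k n) (c n + t / of_real (Q n)) / of_real (Q n)" for n t
  proof -
    have "((\<lambda>t. c n + t / of_real (Q n)) has_field_derivative 1 / of_real (Q n)) (at t)"
      using Q0[of n] by (auto intro!: derivative_eq_intros)
    from DERIV_chain2[OF derk this] show ?thesis
      unfolding \<phi>_def by (intro DERIV_imp_deriv) simp
  qed
  have norm_der\<phi>: "norm (deriv (\<phi> n) 0) = 1" for n
    using Q0[of n] by (simp add: der\<phi> norm_divide Q_def)
  obtain F r where F: "F holomorphic_on UNIV" and r: "strict_mono (r :: nat \<Rightarrow> nat)"
    and lim: "\<And>K. compact K \<Longrightarrow> uniform_limit K (\<lambda>n. \<phi> (r n)) F sequentially"
  proof (rule Montel[of UNIV "range \<phi>" \<phi>])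
    show "h holomorphic_on UNIV" if "h \<in> range \<phi>" for h using that hol\<phi> by auto
    show "\<exists>B. \<forall>h\<in>range \<phi>. \<forall>x\<in>K. norm (h x) \<le> B" if K: "compact K" "K \<subseteq> UNIV" for K
    proof -
      obtain T where T: "\<And>x. x \<in> K \<Longrightarrow> norm x \<le> T"
        using compact_imp_bounded[OF K(1)] by (auto simp: bounded_iff)
      obtain N where N: "\<And>n. n \<ge> N \<Longrightarrow> ln (M n) \<ge> 16 * T"
        using lnM by (auto simp: filterlim_at_top eventually_sequentially)
      have "\<exists>B. \<forall>x\<in>K. norm (\<phi> n x) \<le> B" for n
        using compact_imp_bounded[OF compact_continuous_image[OF entire_continuous_on[OF hol\<phi>] K(1)]]
        by (auto simp: bounded_iff)
      then obtain B where B: "\<And>n x. x \<in> K \<Longrightarrow> norm (\<phi> n x) \<le> B n" by metis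
      \<comment> \<open>The growth bound covers \<open>K\<close> only from the index
        \<open>N\<close> on; the sum takes care of the finitely many earlier functions, as Montel's
        theorem is applied to the whole family.\<close>
      have "norm (\<phi> n x) \<le> exp (4 * T) + (\<Sum>i<N. \<bar>B i\<bar>)" if x: "x \<in> K" for n x
      proof (cases "n < N")
        case True
        then have "\<bar>B n\<bar> \<le> (\<Sum>i<N. \<bar>B i\<bar>)" by (intro member_le_sum) auto
        then show ?thesis using B[OF x, of n] exp_ge_zero[of "4 * T"] by linarith
      next
        case False
        then have "norm (\<phi> n x) \<le> exp (4 * norm x)"
          using growth[of x n] N[of n] T[OF x] by (simp add: \<phi>_def Q_def)
        also have "\<dots> \<le> exp (4 * T)" using T[OF x] by simp
        finally show ?thesis by (simp add: add_increasing2 sum_nonneg)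
      qed
      then show ?thesis by blast
    qed
  qed (auto simp: o_def)
  \<comment> \<open>The normalisation of the derivative at 0 passes to the limit and keeps
    \<open>F\<close> from being constant.\<close>
  have "(\<lambda>n. deriv (\<phi> (r n)) 0) \<longlonglongrightarrow> deriv F 0"
    by (rule deriv_complex_uniform_limit[where A = "ball 0 1"])
       (auto intro: uniform_limit_on_subset[OF lim[of "cball 0 1"]]
          intro!: always_eventually holomorphic_on_subset[OF hol\<phi>])
  from tendsto_norm[OF this] have "norm (deriv F 0) = 1"
    by (simp add: norm_der\<phi> LIMSEQ_const_iff)
  then obtain b0 t0 where b0: "0 < b0" "b0 < 1" and t0: "F t0 = \<i> * of_real b0" "deriv F t0 \<noteq> 0"
    using noncritical_imaginary_value[OF F] by force
  \<comment> \<open>A quarter leaves room for two losses of at most \<mu>: the variation of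
    \<open>deriv F\<close> near \<open>t0\<close> and the passage from \<open>F\<close> to the
    rescaled functions.\<close>
  define \<mu> where "\<mu> = norm (deriv F t0) / 4"
  have \<mu>: "\<mu> > 0" using t0 by (simp add: \<mu>_def)
  have "isCont (deriv F) t0"
    using entire_continuous_on[OF holomorphic_deriv[OF F open_UNIV], of UNIV]
    by (simp add: continuous_on_eq_continuous_at)
  then obtain \<epsilon>0 where \<epsilon>0: "\<epsilon>0 > 0" "\<And>t. dist t t0 < \<epsilon>0 \<Longrightarrow> dist (deriv F t) (deriv F t0) < \<mu>"
    unfolding continuous_at_eps_delta using \<mu> by metis
  define \<epsilon> where "\<epsilon> = min \<epsilon>0 1"
  have \<epsilon>: "\<epsilon> > 0" "\<epsilon> \<le> 1" using \<epsilon>0 by (auto simp: \<epsilon>_def)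
  have dF: "norm (deriv F t) \<ge> 2 * \<mu>" if "t \<in> ball t0 \<epsilon>" for t
  proof -
    have "dist (deriv F t) (deriv F t0) < \<mu>" using that by (intro \<epsilon>0) (simp add: \<epsilon>_def dist_commute)
    then have "norm (deriv F t0 - deriv F t) < \<mu>" by (simp add: dist_norm norm_minus_commute)
    moreover have "norm (deriv F t0) = 4 * \<mu>" by (simp add: \<mu>_def)
    ultimately show ?thesis using norm_triangle_ineq2[of "deriv F t0" "deriv F t"] \<mu> by linarith
  qed

  \<comment> \<open>The points of the \<open>g\<close>-plane are \<open>w n * exp S\<close>; adding \<open>2 * pi * \<i> * j n\<close> to \<open>S\<close> changes the
    preimage \<open>z n * exp (\<theta> n S / \<nu> n)\<close> only. In the coordinate of \<open>k n\<close> these preimages are the values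
    \<open>A n t\<close>, and the choice of \<open>j n\<close> makes them converge to \<open>\<i> * b0\<close>.\<close>
  define j where "j n = \<lfloor>b0 * m n / (8 * pi)\<rfloor>" for n
  define S where "S n t = c n + t / of_real (Q n) + (2 * of_int (j n) * of_real pi) * \<i>" for n t
  define A where "A n t = of_real (4 * \<nu> n / m n) * (exp (\<theta> n (S n t) / of_real (\<nu> n)) - 1)" for n t
  \<comment> \<open>Bounds \<open>c n + t / Q n\<close> once \<open>Q n \<ge> 1\<close>: the first
    two terms come from \<open>c n\<close>, the others from \<open>t\<close>.\<close>
  define C where "C = 2 * P + 4 + norm t0 + 1"
  have C: "C > 0" using P by (simp add: C_def add_pos_nonneg)
  have expS: "exp (S n t) = exp (c n + t / of_real (Q n))" for n t
    using exp_integer_2pi[of "of_int (j n)"] by (simp add: S_def exp_add)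
  \<comment> \<open>The first condition forces \<open>Q n \<ge> 1\<close>, the second makes
    \<open>m n\<close> large enough to keep the shifted points \<open>S n t\<close> inside the disc
    of the exponential law.\<close>
  obtain n1 where n1: "\<And>n. n \<ge> n1 \<Longrightarrow> ln (M n) \<ge> 8 * P" "real n1 \<ge> 2 * (C + 8)"
  proof -
    obtain N where N: "\<And>n. n \<ge> N \<Longrightarrow> ln (M n) \<ge> 8 * P"
      using lnM by (auto simp: filterlim_at_top eventually_sequentially)
    obtain N' where "real N' \<ge> 2 * (C + 8)" using real_arch_simple by blast
    then show thesis using that[of "max N N'"] N by auto
  qed
  have Q1: "Q n \<ge> 1" if "n \<ge> n1" for n
  proof -
    have "1 \<le> ln (M n) / (8 * P)" using n1(1)[OF that] P by simp
    then show ?thesis using QM[of n] by linarith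
  qed
  have ct: "norm (c n + t / of_real (Q n)) \<le> C" if "n \<ge> n1" "t \<in> ball t0 \<epsilon>" for n t
  proof -
    have "norm t \<le> norm t0 + 1"
      using that(2) \<epsilon>(2) norm_triangle_ineq2[of t t0] by (simp add: dist_norm norm_minus_commute)
    moreover have "norm t / Q n \<le> norm t / 1" using Q1[OF that(1)] by (intro divide_left_mono) auto
    ultimately have "norm (t / of_real (Q n)) \<le> norm t0 + 1" using Q0[of n] by (simp add: norm_divide)
    then show ?thesis
      using norm_triangle_ineq[of "c n" "t / of_real (Q n)"] c(1)[of n] by (simp add: C_def)
  qed
  have Sj: "norm (S n t - \<i> * of_real (b0 * m n / 4)) \<le> C + 7" if "n \<ge> n1" "t \<in> ball t0 \<epsilon>" for n t
  proof -
    define x where "x = b0 * m n / (8 * pi)"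
    \<comment> \<open>Rounding displaces \<open>S\<close> by at most one period, and
      \<open>2 * pi \<le> 7\<close>.\<close>
    have "\<bar>of_int (j n) - x\<bar> \<le> 1" by (simp add: j_def x_def) linarith
    then have "2 * pi * \<bar>of_int (j n) - x\<bar> \<le> 2 * pi * 1" by (intro mult_left_mono) auto
    also have "2 * pi * 1 \<le> 7" using pi_approx by simp
    also have "2 * pi * \<bar>of_int (j n) - x\<bar> = \<bar>2 * pi * of_int (j n) - 2 * pi * x\<bar>"
      unfolding right_diff_distrib[symmetric] abs_mult using pi_gt_zero by simp
    finally have "\<bar>2 * pi * of_int (j n) - 2 * pi * x\<bar> \<le> 7" .
    moreover have "2 * pi * x = b0 * m n / 4" by (simp add: x_def)
    moreover have "S n t - \<i> * of_real (b0 * m n / 4) =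
        (c n + t / of_real (Q n)) + \<i> * of_real (2 * pi * of_int (j n) - b0 * m n / 4)"
      by (simp add: S_def algebra_simps)
    ultimately show ?thesis
      using norm_triangle_mono[OF ct[OF that], of "\<i> * of_real (2 * pi * of_int (j n) - b0 * m n / 4)" 7]
      by (simp add: norm_mult del: of_real_diff of_real_mult)
  qed
  have mC: "m n \<ge> 2 * (C + 7 + 1)" if "n \<ge> n1" for n using n1(2) that by (simp add: m_def)
  have nS: "norm (S n t) < m n - 1" if "n \<ge> n1" "t \<in> ball t0 \<epsilon>" for n t
  proof -
    have "norm (\<i> * complex_of_real (b0 * m n / 4)) = b0 * m n / 4"
      using b0 m4[of n] by (simp add: norm_mult)
    also have "\<dots> \<le> m n / 4" using b0 m4[of n] by simp
    finally have "norm (S n t) \<le> C + 7 + m n / 4"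
      using norm_triangle_mono[OF Sj[OF that]] by fastforce
    moreover have "C + 7 \<le> m n / 2 - 1" using mC[OF that(1)] by simp
    moreover have "m n / 2 + m n / 4 < m n" using m4[of n] by simp
    ultimately show ?thesis by linarith
  qed
  have Ab: "norm (A n t - \<i> * of_real b0) \<le> (40 + 4 * (C + 7)) / m n" if "n \<ge> n1" "t \<in> ball t0 \<epsilon>" for n t
    unfolding A_def
    by (rule target_approximation[OF m4 mC[OF that(1)] nu(1) b0 Sj[OF that]])
       (use \<theta>[of "S n t" n] nS[OF that] in auto)
  have holA: "A n holomorphic_on ball t0 \<epsilon>" if "n \<ge> n1" for n
  proof -
    have "S n holomorphic_on ball t0 \<epsilon>" unfolding S_def
      by (intro holomorphic_intros) (use Q0[of n] in auto)
    moreover have "S n ` ball t0 \<epsilon> \<subseteq> ball 0 (m n)" using nS[OF that] by fastforce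
    ultimately have "(\<lambda>t. \<theta> n (S n t)) holomorphic_on ball t0 \<epsilon>"
      using holomorphic_on_compose_gen[OF _ hol\<theta>] by (fastforce simp: o_def)
    then show ?thesis unfolding A_def
      by (intro holomorphic_intros) (use nu_pos[of n] in auto)
  qed
  have r_ge: "r n \<ge> n" for n using seq_suble[OF r] .
  have limA: "uniform_limit (ball t0 \<epsilon>) (\<lambda>n. A (r n)) (\<lambda>_. \<i> * of_real b0) sequentially"
    unfolding uniform_limit_sequentially_iff
  proof (intro allI impI)
    fix e :: real assume e: "e > 0"
    obtain N :: nat where N: "real N > (40 + 4 * (C + 7)) / e" using reals_Archimedean2 by blast
    have "dist (A (r n) t) (\<i> * of_real b0) < e" if n: "n \<ge> max N n1" and t: "t \<in> ball t0 \<epsilon>" for n t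
    proof -
      have rn: "r n \<ge> n1" "r n \<ge> N" using r_ge[of n] n by auto
      then have "m (r n) > (40 + 4 * (C + 7)) / e" using N by (simp add: m_def)
      then have "(40 + 4 * (C + 7)) / m (r n) < e"
        using e m4[of "r n"] by (simp add: pos_divide_less_eq mult.commute)
      then show ?thesis using Ab[OF rn(1) t] by (simp add: dist_norm)
    qed
    then show "\<exists>N. \<forall>n\<ge>N. \<forall>t\<in>ball t0 \<epsilon>. dist (A (r n) t) (\<i> * of_real b0) < e" by blast
  qed

  \<comment> \<open>Solutions of the fixed point equation by Hurwitz' theorem\<close>
  have zeros: "\<exists>n\<ge>n0. \<exists>t\<in>ball t0 \<epsilon>. \<phi> (r n) t = A (r n) t" for n0
  proof (rule frequently_zero_near_limit_zero[OF \<epsilon>(1) _ _ _ t0 _ limA])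
    show "\<forall>\<^sub>F n in sequentially. A (r n) holomorphic_on ball t0 \<epsilon>"
      using r_ge holA by (intro eventually_sequentiallyI[of n1]) (meson order.trans)
    show "uniform_limit (ball t0 \<epsilon>) (\<lambda>n. \<phi> (r n)) F sequentially"
      by (rule uniform_limit_on_subset[OF lim[OF compact_cball] ball_subset_cball])
  qed (auto intro: holomorphic_on_subset[OF hol\<phi>] holomorphic_on_subset[OF F])
  \<comment> \<open>Radius 2 contains the unit discs about points of the \<epsilon>-ball on which
    Cauchy's estimate compares the derivatives.\<close>
  obtain n2 where n2: "\<And>n t. n \<ge> n2 \<Longrightarrow> t \<in> cball t0 2 \<Longrightarrow> dist (\<phi> (r n) t) (F t) < \<mu>"
    using lim[OF compact_cball, of t0 2] \<mu> unfolding uniform_limit_sequentially_iff by meson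
  have d\<phi>: "norm (deriv (\<phi> (r n)) t) \<ge> \<mu>" if n: "n \<ge> n2" and t: "t \<in> ball t0 \<epsilon>" for n t
  proof -
    have "norm (deriv (\<lambda>t. \<phi> (r n) t - F t) t) \<le> \<mu>"
    proof (rule norm_deriv_le_of_bound)
      show "(\<lambda>t. \<phi> (r n) t - F t) holomorphic_on cball t0 2"
        by (intro holomorphic_intros holomorphic_on_subset[OF hol\<phi>] holomorphic_on_subset[OF F]) auto
      show "cball t 1 \<subseteq> cball t0 2"
        using t \<epsilon>(2) by (simp add: cball_subset_cball_iff dist_commute)
      show "norm (\<phi> (r n) x - F x) \<le> \<mu>" if "x \<in> cball t0 2" for x
        using n2[OF n that] by (simp add: dist_norm)
    qed
    moreover have "deriv (\<lambda>t. \<phi> (r n) t - F t) t = deriv (\<phi> (r n)) t - deriv F t"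
      by (intro deriv_diff holomorphic_on_imp_differentiable_at[OF hol\<phi>]
          holomorphic_on_imp_differentiable_at[OF F]) auto
    ultimately show ?thesis
      using dF[OF t] norm_triangle_ineq2[of "deriv F t" "deriv (\<phi> (r n)) t"]
      by (simp add: norm_minus_commute)
  qed

  \<comment> \<open>Estimates at the fixed points\<close>
  define \<alpha> where "\<alpha> = \<mu> / (48 * P)"
  define \<beta> where "\<beta> = exp (- (C + 1))"
  have "\<exists>\<xi>. f (g \<xi>) = \<xi> \<and> norm \<xi> \<ge> real i \<and>
          norm (deriv (f \<circ> g) \<xi>) \<ge> \<alpha> * ln (max_modulus (\<beta> * max_modulus (norm \<xi>) g) f) \<and>
          norm (g \<xi>) \<ge> (1 - 2 / real (Suc i)) * max_modulus (norm \<xi>) g" for i :: nat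
  proof -
    \<comment> \<open>The factor 3 compensates the loss in
      \<open>norm \<xi> \<ge> norm (z l) / 3\<close>.\<close>
    obtain n t where n: "n \<ge> max (3 * i) (max n1 n2)" and t: "t \<in> ball t0 \<epsilon>"
      and zero: "\<phi> (r n) t = A (r n) t"
      using zeros by blast
    define l where "l = r n"
    have l: "l \<ge> 3 * i" "l \<ge> n1" using n r_ge[of n] by (auto simp: l_def)
    define s where "s = c l + t / of_real (Q l)"
    define \<xi> where "\<xi> = z l * exp (\<theta> l (S l t) / of_real (\<nu> l))"
    have "norm (deriv (\<phi> l) t) \<ge> \<mu>" using d\<phi>[OF _ t, of n] n by (simp add: l_def)
    then have ds: "norm (deriv (k l) s) \<ge> \<mu> * Q l"
      using Q0[of l] by (simp add: der\<phi> s_def norm_divide pos_le_divide_eq)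
    have "Re (S l t) = Re s" by (simp add: S_def s_def)
    then have ReS: "Re (S l t) \<le> C" using ct[OF l(2) t] complex_Re_le_cmod[of s] by (simp add: s_def)
    have ks: "k l s = of_real (4 * \<nu> l / m l) * (exp (\<theta> l (S l t) / of_real (\<nu> l)) - 1)"
      using zero by (simp add: \<phi>_def A_def s_def l_def)
    have gz: "g (z l) \<noteq> 0" using w0[of l] by (simp add: w_def)
    have \<theta>l: "\<forall>S\<in>ball 0 (m l). norm (\<theta> l S - S) \<le> 1 / m l \<and>
              g (z l * exp (\<theta> l S / of_real (\<nu> l))) = g (z l) * exp S"
      using \<theta> by blast
    have mxl: "\<forall>\<sigma>. \<bar>\<sigma>\<bar> \<le> m l + 1 \<longrightarrow>
              max_modulus (norm (z l) * exp (\<sigma> / \<nu> l)) g \<le> norm (g (z l)) * exp (\<sigma> + 1 / m l)"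
      using mx by blast
    have \<mu>Q: "\<mu> * Q l \<ge> 0" using \<mu> Q0[of l] by simp
    note est = fixed_point_estimates[OF holf holg m4[of l] nu(1)[of l] z(2)[of l] gz hol\<theta>[of l] \<theta>l mxl
        nS[OF l(2) t] expS[of l t, folded s_def] ReS ks[unfolded k_def w_def]
        ds[unfolded k_def w_def] \<mu>Q, folded \<xi>_def]
    have M0: "max_modulus (norm \<xi>) g > 0"
      using transcendental_max_modulus_pos[OF assms(2), of "norm \<xi>"] z(2)[of l] by (simp add: \<xi>_def)
    \<comment> \<open>The value of \<beta> cancels \<open>exp (C + 1)\<close>, the most by which the
      maximum modulus of \<open>g\<close> at \<open>norm \<xi>\<close> can exceed
      \<open>norm (w l)\<close>.\<close>
    have "\<beta> * max_modulus (norm \<xi>) g \<le> \<beta> * (norm (g (z l)) * exp (C + 1))"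
      using est(5) by (intro mult_left_mono) (auto simp: \<beta>_def)
    also have "\<dots> = norm (w l)" by (simp add: \<beta>_def w_def flip: exp_add)
    finally have "max_modulus (\<beta> * max_modulus (norm \<xi>) g) f \<le> M l"
      unfolding M_def using M0 by (intro max_modulus_mono[OF holf]) (auto simp: \<beta>_def)
    moreover have "max_modulus (\<beta> * max_modulus (norm \<xi>) g) f > 0"
      using M0 by (intro transcendental_max_modulus_pos[OF assms(1)]) (simp add: \<beta>_def)
    ultimately have "ln (max_modulus (\<beta> * max_modulus (norm \<xi>) g) f) \<le> ln (M l)" by (simp add: ln_mono)
    then have "\<alpha> * ln (max_modulus (\<beta> * max_modulus (norm \<xi>) g) f) \<le> \<alpha> * ln (M l)"
      using \<mu> P by (intro mult_left_mono) (auto simp: \<alpha>_def)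
    \<comment> \<open>The 48 in \<alpha> is 8 from the lower bound for \<open>Q\<close> times 6 from
      \<open>fixed_point_estimates\<close>.\<close>
    also have "\<dots> = \<mu> * (ln (M l) / (8 * P)) / 6" by (simp add: \<alpha>_def)
    also have "\<dots> \<le> \<mu> * Q l / 6" using QM[of l] \<mu> by (intro divide_right_mono mult_left_mono) auto
    also have "\<dots> \<le> norm (deriv (f \<circ> g) \<xi>)" using est(3) .
    finally have 1: "norm (deriv (f \<circ> g) \<xi>) \<ge> \<alpha> * ln (max_modulus (\<beta> * max_modulus (norm \<xi>) g) f)" .
    have "real l \<ge> 3 * real i" using l(1) by linarith
    then have ml: "m l \<ge> 3 * real i + 4" by (simp add: m_def)
    have "2 / m l \<le> 2 / real (Suc i)" using ml by (intro divide_left_mono mult_pos_pos) auto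
    then have "(1 - 2 / real (Suc i)) * max_modulus (norm \<xi>) g \<le> (1 - 2 / m l) * max_modulus (norm \<xi>) g"
      using M0 by (intro mult_right_mono) auto
    then have 2: "norm (g \<xi>) \<ge> (1 - 2 / real (Suc i)) * max_modulus (norm \<xi>) g" using est(4) by linarith
    have 3: "norm \<xi> \<ge> real i" using est(2) zn(4)[of l] ml by linarith
    show ?thesis using 1 2 3 est(1) by blast
  qed
  then obtain \<xi> where \<xi>: "\<And>i. f (g (\<xi> i)) = \<xi> i" "\<And>i. norm (\<xi> i) \<ge> real i"
      "\<And>i. norm (deriv (f \<circ> g) (\<xi> i)) \<ge> \<alpha> * ln (max_modulus (\<beta> * max_modulus (norm (\<xi> i)) g) f)"
      "\<And>i. norm (g (\<xi> i)) \<ge> (1 - 2 / real (Suc i)) * max_modulus (norm (\<xi> i)) g"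
    by metis
  show ?thesis
  proof (intro exI conjI allI)
    show "\<alpha> > 0" "\<beta> > 0" using \<mu> P by (auto simp: \<alpha>_def \<beta>_def)
    show "(f \<circ> g) (\<xi> i) = \<xi> i" for i using \<xi>(1) by simp
    show "filterlim (\<lambda>i. norm (\<xi> i)) at_top sequentially"
      by (rule filterlim_at_top_mono[OF filterlim_real_sequentially]) (simp add: \<xi>(2))
    show "(\<lambda>i. 2 / real (Suc i)) \<longlonglongrightarrow> 0"
      by (rule tendsto_divide_0[OF tendsto_const])
         (intro filterlim_at_top_imp_at_infinity filterlim_compose[OF filterlim_real_sequentially filterlim_Suc])
  qed (use \<xi> in auto)
qed

end
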